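(* The functors $\mathrm{K}:\mathsf{hIS}_0\to\mathsf{KhIS}_0^{\mathrm{CK}}$ and $\mathrm{C}:\mathsf{KhIS}_0^{\mathrm{CK}}\to\mathsf{hIS}_0$ establish a categorical equivalence between $\mathsf{hIS}_0$ and $\mathsf{KhIS}_0^{\mathrm{CK}}$, with natural isomorphisms $\alpha:\mathrm{Id}\Rightarrow \mathrm{C}\circ\mathrm{K}$ and $\beta:\mathrm{Id}\Rightarrow\mathrm{K}\circ\mathrm{C}$.
   Context: A bounded hemi-implicative semilattice is an algebra $(H,\wedge,\to,0,1)$ such that $(H,\wedge)$ is a meet semilattice with least element $0$ and greatest element $1$, $a\to a=1$ for all $a$, and for all $a,b,d$, if $a\le b\to d$ then $a\wedge b\le d$. $\mathsf{hIS}_0$ is the category of these algebras and their algebra homomorphisms. A Kleene poset is a structure $(T,\le,\sim,c)$ such that: (1) $(T,\le)$ is a poset; (2) $\sim$ is a unary operation with $\sim\sim x=x$, and $x\le y$ implies $\sim y\le\sim x$; (3) $c=\sim c$; (4) $x\vee c$ exists for every $x$ (hence $x\wedge c$ exists and equals $\sim(\sim x\vee c)$); (5) for every $x$, $(x\vee c)\wedge(\sim x\vee c)$ exists and equals $c$; (6) for all $x,y$, if $x\wedge c\le y\wedge c$ and $x\vee c\le y\vee c$ then $x\le y$. Here $\wedge,\vee$ denote infima and suprema in $(T,\le)$. The category $\mathsf{KhIS}_0$ has as objects the structures $(T,\le,\sim,\to,c,0,1)$ such that $(T,\le,\sim,c)$ is a Kleene poset, $0$ is least and $1$ greatest, for all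 $x,y$ with $x\ge c$ the infimum $x\wedge y$ exists and $(x\wedge y)\vee c=x\wedge(y\vee c)$, and $\to$ is a binary operation on $T$ such that for all $x,y$: (K1) $c\le x\to(y\vee c)$; (K2) $x\wedge((x\vee c)\to(y\vee c))\le y\vee c$; (K3) $x\to x=1$; (K4) $(x\to y)\wedge c=(\sim x\wedge c)\vee(y\wedge c)$; (K5) $(x\to\sim y)\vee c=((x\vee c)\to(\sim y\vee c))\wedge((y\vee c)\to(\sim x\vee c))$. Morphisms of $\mathsf{KhIS}_0$ are maps $g$ preserving the order, $\sim$ and $\to$, and such that $g(x\wedge y)=g(x)\wedge g(y)$ for all $x,y\ge c$. Condition (CK) for $T$: for all $x,y\ge c$ such that $x\wedge y$ exists and $x\wedge y=c$, there is $z\in T$ with $z\vee c=x$ and $\sim z\vee c=y$. $\mathsf{KhIS}_0^{\mathrm{CK}}$ is the full subcategory of $\mathsf{KhIS}_0$ of objects satisfying (CK). For $H\in\mathsf{hIS}_0$, $\mathrm{K}(H)=\{(a,b)\in H\times H: a\wedge b=0\}$, with order $(a,b)\preceq(d,e)$ iff $a\le d$ and $e\le b$, $\sim(a,b)=(b,a)$, $c=(0,0)$, $0=(0,1)$, $1=(1,0)$, and $(a,b)\to(d,e)=((a\to d)\wedge(e\to b),\,a\wedge e)$. For a morphism $f$, $\mathrm{K}(f)(a,b)=(f(a),f(b))$. For $T\in\mathsf{KhIS}_0$, $\mathrm{C}(T)=\{x\in T:x\ge c\}$ with the restricted operations $\wedge,\to$, least element $c$ and greatest element $1$; for a morphism $g$,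 $\mathrm{C}(g)$ is the restriction of $g$. The maps are $\alpha_H:H\to\mathrm{C}(\mathrm{K}(H))$, $\alpha_H(a)=(a,0)$, and $\beta_T:T\to\mathrm{K}(\mathrm{C}(T))$, $\beta_T(x)=(x\vee c,\sim x\vee c)$. *)

theory Defs
  imports "HOL-Algebra.Lattice" "HOL-Library.FuncSet"
begin

section \<open>Categories, functors and equivalences\<close>

text \<open>Arrows live in hom-sets indexed by their domain and codomain, and the hom-sets need not be
  disjoint. Hence composition takes the three objects involved as arguments, and the arrow part of
  a functor takes domain and codomain: \<open>Comp C X Y Z g f\<close> is \<open>g\<close> after \<open>f\<close> for \<open>f : X \<rightarrow> Y\<close>
  and \<open>g : Y \<rightarrow> Z\<close>.\<close>

record ('o, 'm) category_data =
  Obj :: "'o set"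
  Hom :: "'o \<Rightarrow> 'o \<Rightarrow> 'm set"
  Ident :: "'o \<Rightarrow> 'm"
  Comp :: "'o \<Rightarrow> 'o \<Rightarrow> 'o \<Rightarrow> 'm \<Rightarrow> 'm \<Rightarrow> 'm"

locale category =
  fixes C :: "('o, 'm) category_data"
  assumes Ident_in_Hom: "X \<in> Obj C \<Longrightarrow> Ident C X \<in> Hom C X X"
    and Comp_in_Hom: "\<lbrakk>X \<in> Obj C; Y \<in> Obj C; Z \<in> Obj C; f \<in> Hom C X Y; g \<in> Hom C Y Z\<rbrakk>
      \<Longrightarrow> Comp C X Y Z g f \<in> Hom C X Z"
    and Comp_Ident_right: "\<lbrakk>X \<in> Obj C; Y \<in> Obj C; f \<in> Hom C X Y\<rbrakk>
      \<Longrightarrow> Comp C X X Y f (Ident C X) = f"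
    and Comp_Ident_left: "\<lbrakk>X \<in> Obj C; Y \<in> Obj C; f \<in> Hom C X Y\<rbrakk>
      \<Longrightarrow> Comp C X Y Y (Ident C Y) f = f"
    and Comp_assoc: "\<lbrakk>W \<in> Obj C; X \<in> Obj C; Y \<in> Obj C; Z \<in> Obj C;
        f \<in> Hom C W X; g \<in> Hom C X Y; h \<in> Hom C Y Z\<rbrakk>
      \<Longrightarrow> Comp C W Y Z h (Comp C W X Y g f) = Comp C W X Z (Comp C X Y Z h g) f"

definition full_subcategory :: "('o, 'm) category_data \<Rightarrow> ('o \<Rightarrow> bool) \<Rightarrow> ('o, 'm) category_data"
  where "full_subcategory C P = C\<lparr>Obj := {X \<in> Obj C. P X}\<rparr>"

definition iso_arrow :: "('o, 'm) category_data \<Rightarrow> 'o \<Rightarrow> 'o \<Rightarrow> 'm \<Rightarrow> bool"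
  where "iso_arrow C X Y f \<longleftrightarrow> f \<in> Hom C X Y \<and>
    (\<exists>g \<in> Hom C Y X. Comp C X Y X g f = Ident C X \<and> Comp C Y X Y f g = Ident C Y)"

record ('o, 'm, 'p, 'n) functor_data =
  FObj :: "'o \<Rightarrow> 'p"
  FArr :: "'o \<Rightarrow> 'o \<Rightarrow> 'm \<Rightarrow> 'n"

locale functor_between = source: category C + target: category D
  for C :: "('o, 'm) category_data" and D :: "('p, 'n) category_data" +
  fixes F :: "('o, 'm, 'p, 'n) functor_data"
  assumes FObj_in_Obj: "X \<in> Obj C \<Longrightarrow> FObj F X \<in> Obj D"
    and FArr_in_Hom: "\<lbrakk>X \<in> Obj C; Y \<in> Obj C; f \<in> Hom C X Y\<rbrakk>
      \<Longrightarrow> FArr F X Y f \<in> Hom D (FObj F X) (FObj F Y)"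
    and FArr_Ident: "X \<in> Obj C \<Longrightarrow> FArr F X X (Ident C X) = Ident D (FObj F X)"
    and FArr_Comp: "\<lbrakk>X \<in> Obj C; Y \<in> Obj C; Z \<in> Obj C; f \<in> Hom C X Y; g \<in> Hom C Y Z\<rbrakk>
      \<Longrightarrow> FArr F X Z (Comp C X Y Z g f) =
          Comp D (FObj F X) (FObj F Y) (FObj F Z) (FArr F Y Z g) (FArr F X Y f)"

definition id_functor :: "('o, 'm, 'o, 'm) functor_data"
  where "id_functor = \<lparr>FObj = (\<lambda>X. X), FArr = (\<lambda>X Y f. f)\<rparr>"

definition comp_functor ::
  "('p, 'n, 'q, 'k) functor_data \<Rightarrow> ('o, 'm, 'p, 'n) functor_data \<Rightarrow> ('o, 'm, 'q, 'k) functor_data"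
  where "comp_functor G F = \<lparr>FObj = (\<lambda>X. FObj G (FObj F X)),
    FArr = (\<lambda>X Y f. FArr G (FObj F X) (FObj F Y) (FArr F X Y f))\<rparr>"

locale natural_transformation = F: functor_between C D F + G: functor_between C D G
  for C :: "('o, 'm) category_data" and D :: "('p, 'n) category_data"
    and F G :: "('o, 'm, 'p, 'n) functor_data" +
  fixes \<eta> :: "'o \<Rightarrow> 'n"
  assumes component_in_Hom: "X \<in> Obj C \<Longrightarrow> \<eta> X \<in> Hom D (FObj F X) (FObj G X)"
    and naturality: "\<lbrakk>X \<in> Obj C; Y \<in> Obj C; f \<in> Hom C X Y\<rbrakk>
      \<Longrightarrow> Comp D (FObj F X) (FObj F Y) (FObj G Y) (\<eta> Y) (FArr F X Y f) =
          Comp D (FObj F X) (FObj G X) (FObj G Y) (FArr G X Y f) (\<eta> X)"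

locale natural_isomorphism = natural_transformation +
  assumes component_iso: "X \<in> Obj C \<Longrightarrow> iso_arrow D (FObj F X) (FObj G X) (\<eta> X)"

locale categorical_equivalence =
  F: functor_between C D F + G: functor_between D C G +
  unit: natural_isomorphism C C id_functor "comp_functor G F" \<eta> +
  counit: natural_isomorphism D D id_functor "comp_functor F G" \<epsilon>
  for C :: "('o, 'm) category_data" and D :: "('p, 'n) category_data"
    and F :: "('o, 'm, 'p, 'n) functor_data" and G :: "('p, 'n, 'o, 'm) functor_data"
    and \<eta> :: "'o \<Rightarrow> 'm" and \<epsilon> :: "'p \<Rightarrow> 'n"


section \<open>Bounded hemi-implicative semilattices\<close>

record 'a his = "'a partial_object" +
  hmeet :: "'a \<Rightarrow> 'a \<Rightarrow> 'a" (infixl \<open>\<curlywedge>\<index>\<close> 70)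
  himp :: "'a \<Rightarrow> 'a \<Rightarrow> 'a" (infixr \<open>\<leadsto>\<index>\<close> 65)
  hzero :: 'a (\<open>\<zero>\<index>\<close>)
  hone :: 'a (\<open>\<one>\<index>\<close>)

definition hle :: "'a his \<Rightarrow> 'a \<Rightarrow> 'a \<Rightarrow> bool" (infix \<open>\<preceq>\<index>\<close> 50)
  where "a \<preceq>\<^bsub>H\<^esub> b \<longleftrightarrow> a \<curlywedge>\<^bsub>H\<^esub> b = a"

locale hemi_implicative_semilattice =
  fixes H :: "'a his" (structure)
  assumes hmeet_closed: "\<lbrakk>a \<in> carrier H; b \<in> carrier H\<rbrakk> \<Longrightarrow> a \<curlywedge> b \<in> carrier H"
    and himp_closed: "\<lbrakk>a \<in> carrier H; b \<in> carrier H\<rbrakk> \<Longrightarrow> a \<leadsto> b \<in> carrier H"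
    and hzero_closed: "\<zero> \<in> carrier H"
    and hone_closed: "\<one> \<in> carrier H"
    and hmeet_assoc: "\<lbrakk>a \<in> carrier H; b \<in> carrier H; d \<in> carrier H\<rbrakk>
      \<Longrightarrow> (a \<curlywedge> b) \<curlywedge> d = a \<curlywedge> (b \<curlywedge> d)"
    and hmeet_comm: "\<lbrakk>a \<in> carrier H; b \<in> carrier H\<rbrakk> \<Longrightarrow> a \<curlywedge> b = b \<curlywedge> a"
    and hmeet_idem: "a \<in> carrier H \<Longrightarrow> a \<curlywedge> a = a"
    and hzero_least: "a \<in> carrier H \<Longrightarrow> \<zero> \<preceq> a"
    and hone_greatest: "a \<in> carrier H \<Longrightarrow> a \<preceq> \<one>"
    and himp_self: "a \<in> carrier H \<Longrightarrow> a \<leadsto> a = \<one>"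
    and hemi_implication: "\<lbrakk>a \<in> carrier H; b \<in> carrier H; d \<in> carrier H; a \<preceq> b \<leadsto> d\<rbrakk>
      \<Longrightarrow> a \<curlywedge> b \<preceq> d"

text \<open>Arrows between structures are extensional functions on the carrier, so that equality of
  arrows is equality of maps on the carrier.\<close>

definition his_hom :: "'a his \<Rightarrow> 'a his \<Rightarrow> ('a \<Rightarrow> 'a) set"
  where "his_hom H H' = {f \<in> carrier H \<rightarrow>\<^sub>E carrier H'.
    (\<forall>a\<in>carrier H. \<forall>b\<in>carrier H. f (a \<curlywedge>\<^bsub>H\<^esub> b) = f a \<curlywedge>\<^bsub>H'\<^esub> f b) \<and>
    (\<forall>a\<in>carrier H. \<forall>b\<in>carrier H. f (a \<leadsto>\<^bsub>H\<^esub> b) = f a \<leadsto>\<^bsub>H'\<^esub> f b) \<and>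
    f \<zero>\<^bsub>H\<^esub> = \<zero>\<^bsub>H'\<^esub> \<and> f \<one>\<^bsub>H\<^esub> = \<one>\<^bsub>H'\<^esub>}"

definition hIS0 :: "('a his, 'a \<Rightarrow> 'a) category_data"
  where "hIS0 = \<lparr>Obj = {H. hemi_implicative_semilattice H}, Hom = his_hom,
    Ident = (\<lambda>H. \<lambda>x\<in>carrier H. x), Comp = (\<lambda>H H' H'' g f. compose (carrier H) g f)\<rparr>"


section \<open>Kleene posets with an implication\<close>

record 'a kleene_structure = "'a gorder" +
  neg :: "'a \<Rightarrow> 'a" (\<open>\<sim>\<index> _\<close> [81] 80)
  ctr :: 'a (\<open>\<c>\<index>\<close>)

locale kleene_poset = partial_order T
  for T :: "('a, 'b) kleene_structure_scheme" (structure) +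
  assumes neg_closed: "x \<in> carrier T \<Longrightarrow> \<sim> x \<in> carrier T"
    and ctr_closed: "\<c> \<in> carrier T"
    and neg_neg: "x \<in> carrier T \<Longrightarrow> \<sim> (\<sim> x) = x"
    and neg_antitone: "\<lbrakk>x \<in> carrier T; y \<in> carrier T; x \<sqsubseteq> y\<rbrakk> \<Longrightarrow> \<sim> y \<sqsubseteq> \<sim> x"
    and neg_ctr: "\<c> = \<sim> \<c>"
    and join_ctr_exists: "x \<in> carrier T \<Longrightarrow> \<exists>s. is_lub T s {x, \<c>}"
    and kleene: "x \<in> carrier T \<Longrightarrow> is_glb T \<c> {x \<squnion> \<c>, \<sim> x \<squnion> \<c>}"
    and le_if_parts_le: "\<lbrakk>x \<in> carrier T; y \<in> carrier T;
        x \<sqinter> \<c> \<sqsubseteq> y \<sqinter> \<c>; x \<squnion> \<c> \<sqsubseteq> y \<squnion> \<c>\<rbrakk> \<Longrightarrow> x \<sqsubseteq> y"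

record 'a khis = "'a kleene_structure" +
  kimp :: "'a \<Rightarrow> 'a \<Rightarrow> 'a" (infixr \<open>\<rightharpoonup>\<index>\<close> 65)
  kzero :: 'a
  kone :: 'a

text \<open>The operations \<open>\<sqinter>\<close> and \<open>\<squnion>\<close> are choice terms that are meaningful only when the infimum or supremum
  exists. All those occurring below do exist: joins with \<open>\<c>\<close> by \<open>join_ctr_exists\<close>, meets with
  an element above \<open>\<c>\<close> by \<open>upper_meet_exists\<close>, and joins of two elements below \<open>\<c>\<close> by
  duality via \<open>\<sim>\<close>.\<close>

locale kleene_his = kleene_poset T
  for T :: "'a khis" (structure) +
  assumes kimp_closed: "\<lbrakk>x \<in> carrier T; y \<in> carrier T\<rbrakk> \<Longrightarrow> x \<rightharpoonup> y \<in> carrier T"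
    and kzero_least: "least T (kzero T) (carrier T)"
    and kone_greatest: "greatest T (kone T) (carrier T)"
    and upper_meet_exists: "\<lbrakk>x \<in> carrier T; y \<in> carrier T; \<c> \<sqsubseteq> x\<rbrakk> \<Longrightarrow> \<exists>m. is_glb T m {x, y}"
    and upper_meet_distrib: "\<lbrakk>x \<in> carrier T; y \<in> carrier T; \<c> \<sqsubseteq> x\<rbrakk>
      \<Longrightarrow> (x \<sqinter> y) \<squnion> \<c> = x \<sqinter> (y \<squnion> \<c>)"
    and K1: "\<lbrakk>x \<in> carrier T; y \<in> carrier T\<rbrakk> \<Longrightarrow> \<c> \<sqsubseteq> x \<rightharpoonup> (y \<squnion> \<c>)"
    and K2: "\<lbrakk>x \<in> carrier T; y \<in> carrier T\<rbrakk>
      \<Longrightarrow> x \<sqinter> ((x \<squnion> \<c>) \<rightharpoonup> (y \<squnion> \<c>)) \<sqsubseteq> y \<squnion> \<c>"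
    and K3: "x \<in> carrier T \<Longrightarrow> x \<rightharpoonup> x = kone T"
    and K4: "\<lbrakk>x \<in> carrier T; y \<in> carrier T\<rbrakk>
      \<Longrightarrow> (x \<rightharpoonup> y) \<sqinter> \<c> = (\<sim> x \<sqinter> \<c>) \<squnion> (y \<sqinter> \<c>)"
    and K5: "\<lbrakk>x \<in> carrier T; y \<in> carrier T\<rbrakk>
      \<Longrightarrow> (x \<rightharpoonup> \<sim> y) \<squnion> \<c> =
          ((x \<squnion> \<c>) \<rightharpoonup> (\<sim> y \<squnion> \<c>)) \<sqinter> ((y \<squnion> \<c>) \<rightharpoonup> (\<sim> x \<squnion> \<c>))"

definition khis_hom :: "'a khis \<Rightarrow> 'a khis \<Rightarrow> ('a \<Rightarrow> 'a) set"
  where "khis_hom T T' = {g \<in> carrier T \<rightarrow>\<^sub>E carrier T'.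
    (\<forall>x\<in>carrier T. \<forall>y\<in>carrier T. x \<sqsubseteq>\<^bsub>T\<^esub> y \<longrightarrow> g x \<sqsubseteq>\<^bsub>T'\<^esub> g y) \<and>
    (\<forall>x\<in>carrier T. g (\<sim>\<^bsub>T\<^esub> x) = \<sim>\<^bsub>T'\<^esub> (g x)) \<and>
    (\<forall>x\<in>carrier T. \<forall>y\<in>carrier T. g (x \<rightharpoonup>\<^bsub>T\<^esub> y) = g x \<rightharpoonup>\<^bsub>T'\<^esub> g y) \<and>
    (\<forall>x\<in>carrier T. \<forall>y\<in>carrier T. \<c>\<^bsub>T\<^esub> \<sqsubseteq>\<^bsub>T\<^esub> x \<longrightarrow> \<c>\<^bsub>T\<^esub> \<sqsubseteq>\<^bsub>T\<^esub> y \<longrightarrow>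
      g (x \<sqinter>\<^bsub>T\<^esub> y) = g x \<sqinter>\<^bsub>T'\<^esub> g y)}"

definition KhIS0 :: "('a khis, 'a \<Rightarrow> 'a) category_data"
  where "KhIS0 = \<lparr>Obj = {T. kleene_his T}, Hom = khis_hom,
    Ident = (\<lambda>T. \<lambda>x\<in>carrier T. x), Comp = (\<lambda>T T' T'' g f. compose (carrier T) g f)\<rparr>"

definition CK :: "'a khis \<Rightarrow> bool"
  where "CK T \<longleftrightarrow> (\<forall>x\<in>carrier T. \<forall>y\<in>carrier T.
    \<c>\<^bsub>T\<^esub> \<sqsubseteq>\<^bsub>T\<^esub> x \<longrightarrow> \<c>\<^bsub>T\<^esub> \<sqsubseteq>\<^bsub>T\<^esub> y \<longrightarrow> is_glb T \<c>\<^bsub>T\<^esub> {x, y} \<longrightarrow>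
    (\<exists>z\<in>carrier T. z \<squnion>\<^bsub>T\<^esub> \<c>\<^bsub>T\<^esub> = x \<and> \<sim>\<^bsub>T\<^esub> z \<squnion>\<^bsub>T\<^esub> \<c>\<^bsub>T\<^esub> = y))"

definition KhIS0_CK :: "('a khis, 'a \<Rightarrow> 'a) category_data"
  where "KhIS0_CK = full_subcategory KhIS0 CK"


section \<open>The functors and the natural isomorphisms\<close>

text \<open>The elements of \<open>K(H)\<close> are ordered pairs of elements of \<open>H\<close>. For \<open>K\<close> to be a functor between
  two fixed categories, the carriers on both sides are subsets of one type that is closed under
  pairing: the type freely generated from \<open>'a\<close> by an injective pairing. As \<open>'a\<close> is
  arbitrary, every structure whose carrier is a set of elements of some type has (via \<open>Atom\<close>)
  an isomorphic copy of this kind.\<close>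

datatype 'a universe = Atom 'a | Pr (pr1: "'a universe") (pr2: "'a universe")

definition K_obj :: "'a universe his \<Rightarrow> 'a universe khis"
  where "K_obj H =
    \<lparr>carrier = {Pr a b | a b. a \<in> carrier H \<and> b \<in> carrier H \<and> a \<curlywedge>\<^bsub>H\<^esub> b = \<zero>\<^bsub>H\<^esub>},
     eq = (=),
     le = (\<lambda>p q. pr1 p \<preceq>\<^bsub>H\<^esub> pr1 q \<and> pr2 q \<preceq>\<^bsub>H\<^esub> pr2 p),
     neg = (\<lambda>p. Pr (pr2 p) (pr1 p)),
     ctr = Pr \<zero>\<^bsub>H\<^esub> \<zero>\<^bsub>H\<^esub>,
     kimp = (\<lambda>p q. Pr ((pr1 p \<leadsto>\<^bsub>H\<^esub> pr1 q) \<curlywedge>\<^bsub>H\<^esub> (pr2 q \<leadsto>\<^bsub>H\<^esub> pr2 p)) (pr1 p \<curlywedge>\<^bsub>H\<^esub> pr2 q)),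
     kzero = Pr \<zero>\<^bsub>H\<^esub> \<one>\<^bsub>H\<^esub>,
     kone = Pr \<one>\<^bsub>H\<^esub> \<zero>\<^bsub>H\<^esub>\<rparr>"

definition K_functor ::
  "('a universe his, 'a universe \<Rightarrow> 'a universe, 'a universe khis, 'a universe \<Rightarrow> 'a universe) functor_data"
  where "K_functor = \<lparr>FObj = K_obj,
    FArr = (\<lambda>H H' f. \<lambda>p\<in>carrier (K_obj H). Pr (f (pr1 p)) (f (pr2 p)))\<rparr>"

definition C_obj :: "'a khis \<Rightarrow> 'a his"
  where "C_obj T =
    \<lparr>carrier = {x \<in> carrier T. \<c>\<^bsub>T\<^esub> \<sqsubseteq>\<^bsub>T\<^esub> x}, hmeet = meet T, himp = kimp T,
     hzero = \<c>\<^bsub>T\<^esub>, hone = kone T\<rparr>"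

definition C_functor :: "('a khis, 'a \<Rightarrow> 'a, 'a his, 'a \<Rightarrow> 'a) functor_data"
  where "C_functor = \<lparr>FObj = C_obj, FArr = (\<lambda>T T' g. restrict g (carrier (C_obj T)))\<rparr>"

definition alpha :: "'a universe his \<Rightarrow> 'a universe \<Rightarrow> 'a universe"
  where "alpha H = (\<lambda>a\<in>carrier H. Pr a \<zero>\<^bsub>H\<^esub>)"

definition beta :: "'a universe khis \<Rightarrow> 'a universe \<Rightarrow> 'a universe"
  where "beta T = (\<lambda>x\<in>carrier T. Pr (x \<squnion>\<^bsub>T\<^esub> \<c>\<^bsub>T\<^esub>) (\<sim>\<^bsub>T\<^esub> x \<squnion>\<^bsub>T\<^esub> \<c>\<^bsub>T\<^esub>))"

end

theory Submission
  imports Defs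
begin

text \<open>An element \<open>x\<close> of a Kleene poset is determined, together with its position in the order, by the
  pair \<open>(x \<squnion> \<c>, \<sim> x \<squnion> \<c>)\<close> of elements above \<open>\<c>\<close>, whose meet is \<open>\<c>\<close>; (CK) says that all such pairs
  arise. In these coordinates (K4) and (K5) become the formula defining the implication of \<open>K(H)\<close>,
  so \<open>\<beta>\<close> is an isomorphism. Naturality of \<open>\<beta>\<close> requires that morphisms preserve joins with \<open>\<c>\<close>,
  which has to be extracted from preservation of \<open>\<rightharpoonup>\<close> and of the order.\<close>

section \<open>Binary suprema and infima\<close>

text \<open>Infima and suprema are choice terms for partially defined operations, so each equation
  between them is obtained from an explicit infimum or supremum. Meets in \<open>K_obj H\<close> are
  computed only when one factor is above \<open>\<c>\<close>: otherwise the second coordinate of the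
  meet would be a join, which a semilattice need not have. Preservation of \<open>\<c>\<close> by a
  morphism also has to be derived; it holds because \<open>\<c>\<close> is the only fixpoint of
  \<open>\<sim>\<close>. On the poset side an isomorphism is more than a bijective morphism, since
  the inverse of a monotone bijection need not be monotone; for \<open>beta\<close> monotonicity of
  the inverse comes from \<open>le_if_parts_le\<close>. (CK) enters where \<open>beta\<close> is
  shown to be surjective.\<close>

lemma is_lub_pair_iff:
  fixes L (structure)
  assumes "x \<in> carrier L" "y \<in> carrier L"
  shows "is_lub L s {x, y} \<longleftrightarrow>
    s \<in> carrier L \<and> x \<sqsubseteq> s \<and> y \<sqsubseteq> s \<and> (\<forall>z\<in>carrier L. x \<sqsubseteq> z \<longrightarrow> y \<sqsubseteq> z \<longrightarrow> s \<sqsubseteq> z)"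
  using assms by (auto simp: least_def Upper_def)

lemma is_glb_pair_iff:
  fixes L (structure)
  assumes "x \<in> carrier L" "y \<in> carrier L"
  shows "is_glb L m {x, y} \<longleftrightarrow>
    m \<in> carrier L \<and> m \<sqsubseteq> x \<and> m \<sqsubseteq> y \<and> (\<forall>z\<in>carrier L. z \<sqsubseteq> x \<longrightarrow> z \<sqsubseteq> y \<longrightarrow> z \<sqsubseteq> m)"
  using assms by (auto simp: greatest_def Lower_def)

lemma is_glb_commute: "is_glb L m {x, y} \<longleftrightarrow> is_glb L m {y, x}"
  by (simp add: insert_commute)

context partial_order
begin

text \<open>Suprema in a partial order are unique, so the choice term can only return the supremum
  at hand.\<close>

lemma join_eqI: "is_lub L s {x, y} \<Longrightarrow> x \<squnion> y = s"
  unfolding join_def sup_def by (metis least_unique someI_ex)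

lemma meet_eqI: "is_glb L m {x, y} \<Longrightarrow> x \<sqinter> y = m"
  unfolding meet_def inf_def by (metis greatest_unique someI_ex)

lemma is_lub_join: "\<exists>s. is_lub L s {x, y} \<Longrightarrow> is_lub L (x \<squnion> y) {x, y}"
  using join_eqI by blast

lemma is_glb_meet: "\<exists>m. is_glb L m {x, y} \<Longrightarrow> is_glb L (x \<sqinter> y) {x, y}"
  using meet_eqI by blast

end


section \<open>The functor into Kleene posets on objects\<close>

context hemi_implicative_semilattice
begin

lemma hle_refl: "a \<in> carrier H \<Longrightarrow> a \<preceq> a"
  by (simp add: hle_def hmeet_idem)

lemma hle_antisym: "\<lbrakk>a \<in> carrier H; b \<in> carrier H; a \<preceq> b; b \<preceq> a\<rbrakk> \<Longrightarrow> a = b"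
  by (metis hle_def hmeet_comm)

lemma hle_trans:
  "\<lbrakk>a \<in> carrier H; b \<in> carrier H; d \<in> carrier H; a \<preceq> b; b \<preceq> d\<rbrakk> \<Longrightarrow> a \<preceq> d"
  by (metis hle_def hmeet_assoc)

lemma hmeet_lower1: "\<lbrakk>a \<in> carrier H; b \<in> carrier H\<rbrakk> \<Longrightarrow> a \<curlywedge> b \<preceq> a"
  by (metis hle_def hmeet_assoc hmeet_comm hmeet_idem)

lemma hmeet_lower2: "\<lbrakk>a \<in> carrier H; b \<in> carrier H\<rbrakk> \<Longrightarrow> a \<curlywedge> b \<preceq> b"
  by (simp add: hle_def hmeet_assoc hmeet_idem)

lemma hmeet_greatest:
  "\<lbrakk>a \<in> carrier H; b \<in> carrier H; d \<in> carrier H; d \<preceq> a; d \<preceq> b\<rbrakk> \<Longrightarrow> d \<preceq> a \<curlywedge> b"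
  by (metis hle_def hmeet_assoc)

lemma hle_hmeet_iff:
  assumes "a \<in> carrier H" "b \<in> carrier H" "d \<in> carrier H"
  shows "d \<preceq> a \<curlywedge> b \<longleftrightarrow> d \<preceq> a \<and> d \<preceq> b"
  using assms hmeet_greatest hle_trans hmeet_closed hmeet_lower1 hmeet_lower2 by metis

lemma hle_hzero_iff: "a \<in> carrier H \<Longrightarrow> a \<preceq> \<zero> \<longleftrightarrow> a = \<zero>"
  using hle_antisym hzero_least hzero_closed hle_refl by blast

lemma hmeet_hzero: "a \<in> carrier H \<Longrightarrow> a \<curlywedge> \<zero> = \<zero>" "a \<in> carrier H \<Longrightarrow> \<zero> \<curlywedge> a = \<zero>"
  using hle_def hmeet_comm hzero_closed hzero_least by metis+

lemma hmeet_hone: "a \<in> carrier H \<Longrightarrow> a \<curlywedge> \<one> = a" "a \<in> carrier H \<Longrightarrow> \<one> \<curlywedge> a = a"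
  using hle_def hmeet_comm hone_closed hone_greatest by metis+

text \<open>The hemi-implication condition applied to the reflexive inequality for
  \<open>a \<leadsto> b\<close>. It yields (K2) in \<open>K_obj H\<close> and the closure of its
  carrier under implication.\<close>

lemma hmodus_ponens:
  "\<lbrakk>a \<in> carrier H; b \<in> carrier H\<rbrakk> \<Longrightarrow> a \<curlywedge> (a \<leadsto> b) \<preceq> b"
  using hemi_implication[of "a \<leadsto> b" a b] by (simp add: himp_closed hle_refl hmeet_comm)

end

section \<open>Pairs with meet zero\<close>

locale universe_his = hemi_implicative_semilattice H
  for H :: "'a universe his" (structure)
begin

lemma K_obj_simps:
  "Pr a b \<in> carrier (K_obj H) \<longleftrightarrow> a \<in> carrier H \<and> b \<in> carrier H \<and> a \<curlywedge> b = \<zero>"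
  "Pr a b \<sqsubseteq>\<^bsub>K_obj H\<^esub> Pr d e \<longleftrightarrow> a \<preceq> d \<and> e \<preceq> b"
  "\<sim>\<^bsub>K_obj H\<^esub> Pr a b = Pr b a"
  "\<c>\<^bsub>K_obj H\<^esub> = Pr \<zero> \<zero>"
  "Pr a b \<rightharpoonup>\<^bsub>K_obj H\<^esub> Pr d e = Pr ((a \<leadsto> d) \<curlywedge> (e \<leadsto> b)) (a \<curlywedge> e)"
  "kzero (K_obj H) = Pr \<zero> \<one>"
  "kone (K_obj H) = Pr \<one> \<zero>"
  by (auto simp: K_obj_def)

lemma K_obj_cases:
  assumes "p \<in> carrier (K_obj H)"
  obtains a b where "p = Pr a b" "a \<in> carrier H" "b \<in> carrier H" "a \<curlywedge> b = \<zero>"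
  using assms by (auto simp: K_obj_def)

lemma partial_order_K_obj: "partial_order (K_obj H)"
proof
  show "(.=\<^bsub>K_obj H\<^esub>) = (=)" by (simp add: K_obj_def)
qed (auto simp: K_obj_def hle_refl intro: hle_antisym hle_trans)

text \<open>An upper bound of \<open>\<c>\<close> has second coordinate zero, so only the first
  coordinate is left to compare.\<close>

lemma is_lub_K_obj_ctr:
  assumes "Pr a b \<in> carrier (K_obj H)"
  shows "is_lub (K_obj H) (Pr a \<zero>) {Pr a b, \<c>\<^bsub>K_obj H\<^esub>}"
  using assms
  by (subst is_lub_pair_iff)
    (auto simp: K_obj_simps hzero_closed hmeet_hzero hle_refl hzero_least elim!: K_obj_cases)

text \<open>The second coordinate of an infimum has to be a least upper bound of the two second
  coordinates; with one of them zero it is the other, and no join in \<open>H\<close> is called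
  for.\<close>

lemma is_glb_K_obj_upper:
  assumes "Pr a \<zero> \<in> carrier (K_obj H)" "Pr d e \<in> carrier (K_obj H)"
  shows "is_glb (K_obj H) (Pr (a \<curlywedge> d) e) {Pr a \<zero>, Pr d e}"
  using assms
  by (subst is_glb_pair_iff)
    (auto simp: K_obj_simps hmeet_closed hzero_closed hmeet_hzero hle_refl hzero_least hmeet_assoc
      hmeet_lower1 hmeet_lower2 hle_hmeet_iff elim!: K_obj_cases)

lemma is_glb_K_obj_ctr:
  assumes "Pr a b \<in> carrier (K_obj H)"
  shows "is_glb (K_obj H) (Pr \<zero> b) {Pr a b, \<c>\<^bsub>K_obj H\<^esub>}"
  using assms
  by (subst is_glb_pair_iff)
    (auto simp: K_obj_simps hzero_closed hmeet_hzero hle_refl hzero_least elim!: K_obj_cases)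

text \<open>Below \<open>\<c>\<close> the order is the reversed order of second coordinates, so a
  meet of \<open>H\<close> provides the join. This evaluates the right side of (K4).\<close>

lemma is_lub_K_obj_lower:
  assumes "a \<in> carrier H" "b \<in> carrier H"
  shows "is_lub (K_obj H) (Pr \<zero> (a \<curlywedge> b)) {Pr \<zero> a, Pr \<zero> b}"
  using assms
  by (subst is_lub_pair_iff)
    (auto simp: K_obj_simps hmeet_closed hzero_closed hmeet_hzero hle_refl hzero_least
      hmeet_lower1 hmeet_lower2 hle_hmeet_iff elim!: K_obj_cases)

interpretation K: partial_order "K_obj H"
  by (rule partial_order_K_obj)

text \<open>The centre is written \<open>Pr \<zero> \<zero>\<close> because
  \<open>K_obj_simps\<close> unfolds \<open>\<c>\<close> before these rules can match.\<close>

lemma K_obj_lattice_simps: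
  "\<lbrakk>a \<in> carrier H; b \<in> carrier H; a \<curlywedge> b = \<zero>\<rbrakk> \<Longrightarrow> Pr a b \<squnion>\<^bsub>K_obj H\<^esub> Pr \<zero> \<zero> = Pr a \<zero>"
  "\<lbrakk>a \<in> carrier H; b \<in> carrier H; a \<curlywedge> b = \<zero>\<rbrakk> \<Longrightarrow> Pr a b \<sqinter>\<^bsub>K_obj H\<^esub> Pr \<zero> \<zero> = Pr \<zero> b"
  "\<lbrakk>a \<in> carrier H; d \<in> carrier H; e \<in> carrier H; d \<curlywedge> e = \<zero>\<rbrakk>
    \<Longrightarrow> Pr a \<zero> \<sqinter>\<^bsub>K_obj H\<^esub> Pr d e = Pr (a \<curlywedge> d) e"
  "\<lbrakk>a \<in> carrier H; d \<in> carrier H; e \<in> carrier H; d \<curlywedge> e = \<zero>\<rbrakk>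
    \<Longrightarrow> Pr d e \<sqinter>\<^bsub>K_obj H\<^esub> Pr a \<zero> = Pr (d \<curlywedge> a) e"
  "\<lbrakk>a \<in> carrier H; b \<in> carrier H\<rbrakk> \<Longrightarrow> Pr \<zero> a \<squnion>\<^bsub>K_obj H\<^esub> Pr \<zero> b = Pr \<zero> (a \<curlywedge> b)"
  using is_lub_K_obj_ctr is_glb_K_obj_ctr is_glb_K_obj_upper is_lub_K_obj_lower
  by (auto intro!: K.join_eqI K.meet_eqI
      simp: K_obj_simps hzero_closed hmeet_hzero hmeet_comm is_glb_commute[of _ _ "Pr d e"])

text \<open>Whatever lies below \<open>a\<close> and \<open>a \<leadsto> d\<close> lies below
  \<open>d\<close> by modus ponens; being also below \<open>e\<close>, it is zero because
  \<open>d\<close> and \<open>e\<close> have meet zero.\<close>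

lemma kimp_K_obj_disjoint:
  assumes "a \<in> carrier H" "b \<in> carrier H" "a \<curlywedge> b = \<zero>"
    "d \<in> carrier H" "e \<in> carrier H" "d \<curlywedge> e = \<zero>"
  shows "((a \<leadsto> d) \<curlywedge> (e \<leadsto> b)) \<curlywedge> (a \<curlywedge> e) = \<zero>"
proof -
  let ?t = "((a \<leadsto> d) \<curlywedge> (e \<leadsto> b)) \<curlywedge> (a \<curlywedge> e)"
  have cl: "a \<leadsto> d \<in> carrier H" "e \<leadsto> b \<in> carrier H" "?t \<in> carrier H"
    "a \<curlywedge> (a \<leadsto> d) \<in> carrier H" "(a \<leadsto> d) \<curlywedge> (e \<leadsto> b) \<in> carrier H" "a \<curlywedge> e \<in> carrier H"
    using assms by (auto simp: himp_closed hmeet_closed)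
  have "?t \<preceq> (a \<leadsto> d) \<curlywedge> (e \<leadsto> b)" "?t \<preceq> a \<curlywedge> e"
    using cl by (simp_all add: hmeet_lower1 hmeet_lower2)
  then have parts: "?t \<preceq> a \<leadsto> d" "?t \<preceq> a" "?t \<preceq> e"
    using assms cl by (simp_all add: hle_hmeet_iff)
  then have "?t \<preceq> a \<curlywedge> (a \<leadsto> d)"
    using assms cl by (simp add: hle_hmeet_iff)
  then have "?t \<preceq> d"
    using hle_trans[OF cl(3,4) assms(4)] hmodus_ponens assms by blast
  then have "?t \<preceq> d \<curlywedge> e"
    using parts assms cl by (blast intro: hmeet_greatest)
  then show ?thesis
    using assms cl by (simp add: hle_hzero_iff)
qed

lemmas K_obj_closed_simps = hmeet_closed himp_closed hzero_closed hone_closed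

text \<open>Join and meet with \<open>\<c>\<close> isolate the first and the second coordinate of a
  pair, so an inequality of both parts is the inequality of pairs.\<close>

lemma kleene_poset_K_obj: "kleene_poset (K_obj H)"
proof (intro kleene_poset.intro kleene_poset_axioms.intro partial_order_K_obj)
  fix x assume x: "x \<in> carrier (K_obj H)"
  show "\<exists>s. is_lub (K_obj H) s {x, \<c>\<^bsub>K_obj H\<^esub>}"
    using x is_lub_K_obj_ctr by (metis K_obj_cases)
  show "is_glb (K_obj H) \<c>\<^bsub>K_obj H\<^esub> {x \<squnion>\<^bsub>K_obj H\<^esub> \<c>\<^bsub>K_obj H\<^esub>, \<sim>\<^bsub>K_obj H\<^esub> x \<squnion>\<^bsub>K_obj H\<^esub> \<c>\<^bsub>K_obj H\<^esub>}"
    using x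
  proof (cases x rule: K_obj_cases)
    case (1 a b)
    \<comment> \<open>The two joins are \<open>Pr a \<zero>\<close> and \<open>Pr b \<zero>\<close>,
      with infimum \<open>Pr (a \<curlywedge> b) \<zero>\<close>; this is \<open>\<c>\<close> by the
      membership condition for \<open>Pr a b\<close>.\<close>
    then show ?thesis
      using is_glb_K_obj_upper[of a b \<zero>]
      by (simp add: K_obj_simps K_obj_lattice_simps K_obj_closed_simps hmeet_hzero hmeet_comm)
  qed
qed (auto elim!: K_obj_cases
    simp: K_obj_simps K_obj_lattice_simps K_obj_closed_simps hmeet_hzero hmeet_comm)

text \<open>Cases 1 to 5 are closure, the two bounds, and existence and distributivity of meets
  above \<open>\<c>\<close>; cases 6 to 10 are (K1) to (K5).\<close>

lemma kleene_his_K_obj: "kleene_his (K_obj H)"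
proof (intro kleene_his.intro kleene_his_axioms.intro kleene_poset_K_obj, goal_cases)
  case (1 x y)
  then show ?case
    by (auto elim!: K_obj_cases simp: K_obj_simps K_obj_closed_simps kimp_K_obj_disjoint)
next
  case 2
  then show ?case
    by (auto elim!: K_obj_cases simp: least_def K_obj_simps K_obj_closed_simps hmeet_hzero
        hzero_least hone_greatest)
next
  case 3
  then show ?case
    by (auto elim!: K_obj_cases simp: greatest_def K_obj_simps K_obj_closed_simps hmeet_hzero
        hzero_least hone_greatest)
next
  case (4 x y)
  then obtain a where "x = Pr a \<zero>" by (auto elim!: K_obj_cases simp: K_obj_simps hle_hzero_iff)
  then show ?case
    using 4 is_glb_K_obj_upper by (metis K_obj_cases)
next
  case (5 x y)
  then obtain a where "x = Pr a \<zero>" by (auto elim!: K_obj_cases simp: K_obj_simps hle_hzero_iff)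
  moreover obtain d e where "y = Pr d e" "d \<in> carrier H" "e \<in> carrier H" "d \<curlywedge> e = \<zero>"
    using 5 by (auto elim!: K_obj_cases)
  ultimately show ?case
    using 5 by (simp add: K_obj_simps K_obj_lattice_simps K_obj_closed_simps hmeet_hzero hmeet_assoc)
next
  case (6 x y)
  then show ?case
    by (auto elim!: K_obj_cases simp: K_obj_simps K_obj_lattice_simps K_obj_closed_simps
        hmeet_hzero hzero_least hle_refl)
next
  case (7 x y)
  then obtain a b d e where xy: "x = Pr a b" "y = Pr d e" "a \<in> carrier H" "b \<in> carrier H"
    "a \<curlywedge> b = \<zero>" "d \<in> carrier H" "e \<in> carrier H" "d \<curlywedge> e = \<zero>"
    by (auto elim!: K_obj_cases)
  \<comment> \<open>Above \<open>\<c>\<close> the factor from the second coordinates is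
    \<open>\<zero> \<leadsto> \<zero> = \<one>\<close>, so the inner implication is
    \<open>Pr (a \<leadsto> d) \<zero>\<close> and modus ponens in \<open>H\<close> remains.\<close>
  then show ?case
    by (simp add: K_obj_simps K_obj_lattice_simps K_obj_closed_simps hmeet_hzero himp_self
        hmeet_hone hzero_least hmodus_ponens)
next
  case (8 x)
  then show ?case
    by (auto elim!: K_obj_cases simp: K_obj_simps himp_self K_obj_closed_simps hmeet_hone)
next
  case (9 x y)
  then obtain a b d e where xy: "x = Pr a b" "y = Pr d e" "a \<in> carrier H" "b \<in> carrier H"
    "a \<curlywedge> b = \<zero>" "d \<in> carrier H" "e \<in> carrier H" "d \<curlywedge> e = \<zero>"
    by (auto elim!: K_obj_cases)
  then show ?case
    using kimp_K_obj_disjoint[of a b d e]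
    by (simp add: K_obj_simps K_obj_lattice_simps K_obj_closed_simps hmeet_hzero hmeet_comm)
next
  case (10 x y)
  then obtain a b d e where xy: "x = Pr a b" "y = Pr d e" "a \<in> carrier H" "b \<in> carrier H"
    "a \<curlywedge> b = \<zero>" "d \<in> carrier H" "e \<in> carrier H" "d \<curlywedge> e = \<zero>"
    by (auto elim!: K_obj_cases)
  \<comment> \<open>(K5) is about \<open>x \<rightharpoonup> \<sim> y\<close>, so disjointness is
    used with \<open>e\<close> and \<open>d\<close> exchanged.\<close>
  then show ?case
    using kimp_K_obj_disjoint[of a b e d] hmeet_comm[of e d] hmeet_comm[of b a]
    by (simp add: K_obj_simps K_obj_lattice_simps K_obj_closed_simps himp_self hmeet_hone
        hmeet_hzero)
qed

text \<open>Elements above \<open>\<c>\<close> are pairs \<open>Pr a \<zero>\<close> and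
  \<open>Pr b \<zero>\<close>. Their infimum being \<open>\<c>\<close> means that \<open>a\<close>
  and \<open>b\<close> have meet zero, which is what admits \<open>Pr a b\<close> as the
  witness.\<close>

lemma CK_K_obj: "CK (K_obj H)"
  unfolding CK_def
proof (intro ballI impI)
  fix x y
  assume xy: "x \<in> carrier (K_obj H)" "y \<in> carrier (K_obj H)"
    "\<c>\<^bsub>K_obj H\<^esub> \<sqsubseteq>\<^bsub>K_obj H\<^esub> x" "\<c>\<^bsub>K_obj H\<^esub> \<sqsubseteq>\<^bsub>K_obj H\<^esub> y" "is_glb (K_obj H) \<c>\<^bsub>K_obj H\<^esub> {x, y}"
  then obtain a b where ab: "x = Pr a \<zero>" "y = Pr b \<zero>" "a \<in> carrier H" "b \<in> carrier H"
    by (auto elim!: K_obj_cases simp: K_obj_simps hle_hzero_iff)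
  then have "is_glb (K_obj H) (Pr (a \<curlywedge> b) \<zero>) {x, y}"
    using is_glb_K_obj_upper[of a b \<zero>] xy by simp
  then have disj: "a \<curlywedge> b = \<zero>"
    using K.greatest_unique[OF xy(5)] by (fastforce simp: K_obj_simps)
  show "\<exists>z\<in>carrier (K_obj H). z \<squnion>\<^bsub>K_obj H\<^esub> \<c>\<^bsub>K_obj H\<^esub> = x \<and> \<sim>\<^bsub>K_obj H\<^esub> z \<squnion>\<^bsub>K_obj H\<^esub> \<c>\<^bsub>K_obj H\<^esub> = y"
  proof (rule bexI)
    show "Pr a b \<in> carrier (K_obj H)" using ab disj by (simp add: K_obj_simps)
    show "Pr a b \<squnion>\<^bsub>K_obj H\<^esub> \<c>\<^bsub>K_obj H\<^esub> = x \<and> \<sim>\<^bsub>K_obj H\<^esub> Pr a b \<squnion>\<^bsub>K_obj H\<^esub> \<c>\<^bsub>K_obj H\<^esub> = y"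
      using ab disj hmeet_comm[of b a] by (simp add: K_obj_simps K_obj_lattice_simps)
  qed
qed

end


section \<open>The upper part of a Kleene poset\<close>

context kleene_poset
begin

lemma is_lub_join_ctr: "x \<in> carrier T \<Longrightarrow> is_lub T (x \<squnion> \<c>) {x, \<c>}"
  by (simp add: is_lub_join join_ctr_exists)

lemma join_ctr_closed: "x \<in> carrier T \<Longrightarrow> x \<squnion> \<c> \<in> carrier T"
  using is_lub_join_ctr by blast

lemma join_ctr_upper: "x \<in> carrier T \<Longrightarrow> x \<sqsubseteq> x \<squnion> \<c>" "x \<in> carrier T \<Longrightarrow> \<c> \<sqsubseteq> x \<squnion> \<c>"
  using is_lub_join_ctr ctr_closed by (simp_all add: is_lub_pair_iff)

lemma join_ctr_least:
  "\<lbrakk>x \<in> carrier T; z \<in> carrier T; x \<sqsubseteq> z; \<c> \<sqsubseteq> z\<rbrakk> \<Longrightarrow> x \<squnion> \<c> \<sqsubseteq> z"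
  using is_lub_join_ctr ctr_closed by (simp add: is_lub_pair_iff)

lemma join_ctr_absorb: "\<lbrakk>x \<in> carrier T; \<c> \<sqsubseteq> x\<rbrakk> \<Longrightarrow> x \<squnion> \<c> = x"
  by (simp add: join_ctr_closed join_ctr_least join_ctr_upper le_antisym)

lemma join_ctr_collapse: "\<lbrakk>x \<in> carrier T; x \<sqsubseteq> \<c>\<rbrakk> \<Longrightarrow> x \<squnion> \<c> = \<c>"
  by (simp add: ctr_closed join_ctr_closed join_ctr_least join_ctr_upper le_antisym)

lemma join_ctr_mono:
  "\<lbrakk>x \<in> carrier T; y \<in> carrier T; x \<sqsubseteq> y\<rbrakk> \<Longrightarrow> x \<squnion> \<c> \<sqsubseteq> y \<squnion> \<c>"
  by (meson join_ctr_closed join_ctr_least join_ctr_upper le_trans)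

lemma neg_le_iff: "\<lbrakk>x \<in> carrier T; y \<in> carrier T\<rbrakk> \<Longrightarrow> \<sim> x \<sqsubseteq> \<sim> y \<longleftrightarrow> y \<sqsubseteq> x"
  by (metis neg_antitone neg_closed neg_neg)

lemma neg_le_ctr_iff: "x \<in> carrier T \<Longrightarrow> \<sim> x \<sqsubseteq> \<c> \<longleftrightarrow> \<c> \<sqsubseteq> x"
  by (metis ctr_closed neg_ctr neg_le_iff)

text \<open>Supplies the joins of elements below \<open>\<c>\<close> in (K4), as negated meets of
  elements above \<open>\<c>\<close>.\<close>

lemma is_lub_neg:
  assumes "x \<in> carrier T" "y \<in> carrier T" "is_glb T m {x, y}"
  shows "is_lub T (\<sim> m) {\<sim> x, \<sim> y}"
  using assms
  by (simp add: is_lub_pair_iff is_glb_pair_iff neg_closed neg_le_iff)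
    (metis neg_antitone neg_closed neg_neg)

lemma is_glb_neg:
  assumes "x \<in> carrier T" "y \<in> carrier T" "is_lub T s {x, y}"
  shows "is_glb T (\<sim> s) {\<sim> x, \<sim> y}"
  using assms
  by (simp add: is_lub_pair_iff is_glb_pair_iff neg_closed neg_le_iff)
    (metis neg_antitone neg_closed neg_neg)

text \<open>De Morgan with \<open>\<c> = \<sim> \<c>\<close>. It trades meets with
  \<open>\<c>\<close> for joins with \<open>\<c>\<close>, the coordinates used by
  \<open>beta\<close>.\<close>

lemma meet_ctr_eq: "x \<in> carrier T \<Longrightarrow> x \<sqinter> \<c> = \<sim> (\<sim> x \<squnion> \<c>)"
  using is_glb_neg[of "\<sim> x" \<c>] is_lub_join_ctr[of "\<sim> x"]
  by (intro meet_eqI) (simp add: neg_closed ctr_closed neg_neg flip: neg_ctr)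

text \<open>\<open>le_if_parts_le\<close> with its meets rewritten as negated joins. The right side
  is the order of pairs in \<open>K_obj (C_obj T)\<close>, so \<open>beta\<close> is an order
  embedding.\<close>

lemma le_iff_join_ctr:
  assumes "x \<in> carrier T" "y \<in> carrier T"
  shows "x \<sqsubseteq> y \<longleftrightarrow> x \<squnion> \<c> \<sqsubseteq> y \<squnion> \<c> \<and> \<sim> y \<squnion> \<c> \<sqsubseteq> \<sim> x \<squnion> \<c>"
  using assms le_if_parts_le[of x y]
  by (auto simp: meet_ctr_eq neg_le_iff neg_closed join_ctr_closed join_ctr_mono)

text \<open>For a fixpoint the two joins in the Kleene condition coincide, so their infimum
  \<open>\<c>\<close> equals \<open>x \<squnion> \<c>\<close>. Hence \<open>x\<close> is below
  \<open>\<c>\<close>, and by negation also above it.\<close>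

lemma neg_fixpoint_unique:
  assumes "x \<in> carrier T" "\<sim> x = x"
  shows "x = \<c>"
proof -
  have "is_glb T (x \<squnion> \<c>) {x \<squnion> \<c>, x \<squnion> \<c>}"
    using assms by (subst is_glb_pair_iff) (auto simp: join_ctr_closed)
  then have "x \<squnion> \<c> = \<c>"
    using greatest_unique kleene[of x] assms by simp
  then have "x \<sqsubseteq> \<c>"
    using assms join_ctr_upper(1) by metis
  moreover from this have "\<c> \<sqsubseteq> x"
    using assms neg_le_ctr_iff by metis
  ultimately show ?thesis
    using assms ctr_closed by (simp add: le_antisym)
qed

end

section \<open>Meets above the centre and the coordinates of an implication\<close>

context kleene_his
begin

lemma is_glb_upper_meet:
  "\<lbrakk>x \<in> carrier T; y \<in> carrier T; \<c> \<sqsubseteq> x\<rbrakk> \<Longrightarrow> is_glb T (x \<sqinter> y) {x, y}"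
  by (simp add: is_glb_meet upper_meet_exists)

lemma upper_meet_props:
  assumes "x \<in> carrier T" "y \<in> carrier T" "\<c> \<sqsubseteq> x"
  shows "x \<sqinter> y \<in> carrier T" "x \<sqinter> y \<sqsubseteq> x" "x \<sqinter> y \<sqsubseteq> y"
    "\<And>z. \<lbrakk>z \<in> carrier T; z \<sqsubseteq> x; z \<sqsubseteq> y\<rbrakk> \<Longrightarrow> z \<sqsubseteq> x \<sqinter> y"
  using is_glb_upper_meet[OF assms] assms by (simp_all add: is_glb_pair_iff)

lemma upper_meet_le_iff:
  assumes "x \<in> carrier T" "y \<in> carrier T" "\<c> \<sqsubseteq> x" "z \<in> carrier T"
  shows "z \<sqsubseteq> x \<sqinter> y \<longleftrightarrow> z \<sqsubseteq> x \<and> z \<sqsubseteq> y"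
  using upper_meet_props[OF assms(1-3)] assms le_trans by meson

lemma kone_closed: "kone T \<in> carrier T"
  using kone_greatest by blast

lemma le_kone: "x \<in> carrier T \<Longrightarrow> x \<sqsubseteq> kone T"
  using kone_greatest greatest_le by fast

text \<open>(K5) at \<open>\<sim> y\<close>: the first coordinate of the implication of
  pairs.\<close>

lemma kimp_join_ctr:
  assumes "x \<in> carrier T" "y \<in> carrier T"
  shows "(x \<rightharpoonup> y) \<squnion> \<c> = ((x \<squnion> \<c>) \<rightharpoonup> (y \<squnion> \<c>)) \<sqinter> ((\<sim> y \<squnion> \<c>) \<rightharpoonup> (\<sim> x \<squnion> \<c>))"
  using K5[of x "\<sim> y"] assms by (simp add: neg_closed neg_neg)

text \<open>(K4) under negation: the second coordinate of the implication of pairs. Both sides of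
  (K4) become negations of elements above \<open>\<c>\<close>, and \<open>\<sim>\<close> is
  injective.\<close>

lemma neg_kimp_join_ctr:
  assumes "x \<in> carrier T" "y \<in> carrier T"
  shows "\<sim> (x \<rightharpoonup> y) \<squnion> \<c> = (x \<squnion> \<c>) \<sqinter> (\<sim> y \<squnion> \<c>)"
proof -
  let ?u = "x \<squnion> \<c>" and ?v = "\<sim> y \<squnion> \<c>"
  have uv: "?u \<in> carrier T" "?v \<in> carrier T" "\<c> \<sqsubseteq> ?u"
    using assms by (simp_all add: join_ctr_closed join_ctr_upper neg_closed)
  have "\<sim> (\<sim> (x \<rightharpoonup> y) \<squnion> \<c>) = \<sim> ?u \<squnion> \<sim> ?v"
    using K4[of x y] assms by (simp add: meet_ctr_eq kimp_closed neg_closed neg_neg)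
  also have "\<dots> = \<sim> (?u \<sqinter> ?v)"
    using uv by (intro join_eqI is_lub_neg is_glb_upper_meet)
  finally show ?thesis
    using assms uv neg_neg upper_meet_props(1) by (metis join_ctr_closed kimp_closed neg_closed)
qed

lemma C_obj_simps:
  "x \<in> carrier (C_obj T) \<longleftrightarrow> x \<in> carrier T \<and> \<c> \<sqsubseteq> x"
  "x \<curlywedge>\<^bsub>C_obj T\<^esub> y = x \<sqinter> y" "x \<leadsto>\<^bsub>C_obj T\<^esub> y = x \<rightharpoonup> y"
  "\<zero>\<^bsub>C_obj T\<^esub> = \<c>" "\<one>\<^bsub>C_obj T\<^esub> = kone T"
  by (simp_all add: C_obj_def)

lemma C_obj_le_iff:
  assumes "x \<in> carrier (C_obj T)" "y \<in> carrier (C_obj T)"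
  shows "x \<preceq>\<^bsub>C_obj T\<^esub> y \<longleftrightarrow> x \<sqsubseteq> y"
  using assms upper_meet_props[of x y] le_antisym[of "x \<sqinter> y" x]
  by (auto simp: hle_def C_obj_simps)

lemma kimp_upper: "\<lbrakk>x \<in> carrier T; y \<in> carrier T; \<c> \<sqsubseteq> y\<rbrakk> \<Longrightarrow> \<c> \<sqsubseteq> x \<rightharpoonup> y"
  using K1[of x y] by (simp add: join_ctr_absorb)

lemma hemi_implicative_semilattice_C_obj: "hemi_implicative_semilattice (C_obj T)"
proof
  fix a b d
  assume a: "a \<in> carrier (C_obj T)" and b: "b \<in> carrier (C_obj T)"
  note ab = a[unfolded C_obj_simps] b[unfolded C_obj_simps]
  show ab_closed: "a \<curlywedge>\<^bsub>C_obj T\<^esub> b \<in> carrier (C_obj T)"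
    using ab by (simp add: C_obj_simps upper_meet_props ctr_closed)
  show "a \<leadsto>\<^bsub>C_obj T\<^esub> b \<in> carrier (C_obj T)"
    using ab by (simp add: C_obj_simps kimp_closed kimp_upper)
  show "a \<curlywedge>\<^bsub>C_obj T\<^esub> b = b \<curlywedge>\<^bsub>C_obj T\<^esub> a"
    by (simp add: C_obj_simps meet_def insert_commute)
  assume d: "d \<in> carrier (C_obj T)"
  note abd = ab d[unfolded C_obj_simps]
  show "(a \<curlywedge>\<^bsub>C_obj T\<^esub> b) \<curlywedge>\<^bsub>C_obj T\<^esub> d = a \<curlywedge>\<^bsub>C_obj T\<^esub> (b \<curlywedge>\<^bsub>C_obj T\<^esub> d)"
  proof -
    have cl: "a \<sqinter> b \<in> carrier T" "\<c> \<sqsubseteq> a \<sqinter> b" "b \<sqinter> d \<in> carrier T" "\<c> \<sqsubseteq> b \<sqinter> d"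
      using abd ctr_closed by (simp_all add: upper_meet_props)
    \<comment> \<open>Both bracketings have the same lower bounds; taking each as a lower bound of
      itself gives the two inequalities.\<close>
    then have "z \<sqsubseteq> (a \<sqinter> b) \<sqinter> d \<longleftrightarrow> z \<sqsubseteq> a \<sqinter> (b \<sqinter> d)" if "z \<in> carrier T" for z
      using that abd by (simp add: upper_meet_le_iff)
    from this[of "(a \<sqinter> b) \<sqinter> d"] this[of "a \<sqinter> (b \<sqinter> d)"] show ?thesis
      using abd cl by (simp add: C_obj_simps le_antisym upper_meet_props(1))
  qed
  assume "a \<preceq>\<^bsub>C_obj T\<^esub> b \<leadsto>\<^bsub>C_obj T\<^esub> d"
  then have "a \<sqsubseteq> b \<rightharpoonup> d"
    using C_obj_le_iff[of a "b \<rightharpoonup> d"] a abd by (simp add: C_obj_simps kimp_closed kimp_upper)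
  \<comment> \<open>For arguments above \<open>\<c>\<close> the joins in (K2) are absorbed, which
    leaves modus ponens.\<close>
  moreover have "b \<sqinter> (b \<rightharpoonup> d) \<sqsubseteq> d"
    using K2[of b d] abd by (simp add: join_ctr_absorb)
  ultimately have "a \<sqinter> b \<sqsubseteq> d"
    using abd upper_meet_props[of a b] upper_meet_props[of b "b \<rightharpoonup> d"] kimp_closed[of b d]
    by (meson le_trans)
  then show "a \<curlywedge>\<^bsub>C_obj T\<^esub> b \<preceq>\<^bsub>C_obj T\<^esub> d"
    using C_obj_le_iff[OF ab_closed d] by (simp add: C_obj_simps)
next
  fix a assume a: "a \<in> carrier (C_obj T)"
  show "a \<curlywedge>\<^bsub>C_obj T\<^esub> a = a"
    using a C_obj_le_iff[of a a] by (auto simp: hle_def C_obj_simps)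
  show "\<zero>\<^bsub>C_obj T\<^esub> \<preceq>\<^bsub>C_obj T\<^esub> a"
    using a C_obj_le_iff[of \<c> a] by (auto simp: C_obj_simps ctr_closed)
  show "a \<preceq>\<^bsub>C_obj T\<^esub> \<one>\<^bsub>C_obj T\<^esub>"
    using a C_obj_le_iff[of a "kone T"] by (auto simp: C_obj_simps ctr_closed kone_closed le_kone)
  show "a \<leadsto>\<^bsub>C_obj T\<^esub> a = \<one>\<^bsub>C_obj T\<^esub>"
    using a by (simp add: C_obj_simps K3)
qed (simp_all add: C_obj_simps ctr_closed kone_closed le_kone)

end


section \<open>Homomorphisms\<close>

locale khis_morphism = source: kleene_his T + target: kleene_his T'
  for T T' :: "'a khis" and g +
  assumes hom: "g \<in> khis_hom T T'"
begin

lemma closed: "x \<in> carrier T \<Longrightarrow> g x \<in> carrier T'"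
  and mono: "\<lbrakk>x \<in> carrier T; y \<in> carrier T; x \<sqsubseteq>\<^bsub>T\<^esub> y\<rbrakk> \<Longrightarrow> g x \<sqsubseteq>\<^bsub>T'\<^esub> g y"
  and neg: "x \<in> carrier T \<Longrightarrow> g (\<sim>\<^bsub>T\<^esub> x) = \<sim>\<^bsub>T'\<^esub> (g x)"
  and imp: "\<lbrakk>x \<in> carrier T; y \<in> carrier T\<rbrakk> \<Longrightarrow> g (x \<rightharpoonup>\<^bsub>T\<^esub> y) = g x \<rightharpoonup>\<^bsub>T'\<^esub> g y"
  and upper_meet: "\<lbrakk>x \<in> carrier T; y \<in> carrier T; \<c>\<^bsub>T\<^esub> \<sqsubseteq>\<^bsub>T\<^esub> x; \<c>\<^bsub>T\<^esub> \<sqsubseteq>\<^bsub>T\<^esub> y\<rbrakk>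
    \<Longrightarrow> g (x \<sqinter>\<^bsub>T\<^esub> y) = g x \<sqinter>\<^bsub>T'\<^esub> g y"
  using hom by (auto simp: khis_hom_def)

text \<open>The image of \<open>\<c>\<close> is again fixed by negation, and the target has a single
  such element.\<close>

lemma ctr: "g \<c>\<^bsub>T\<^esub> = \<c>\<^bsub>T'\<^esub>"
  using target.neg_fixpoint_unique[of "g \<c>\<^bsub>T\<^esub>"] neg[of "\<c>\<^bsub>T\<^esub>"]
  by (simp add: closed source.ctr_closed flip: source.neg_ctr)

lemma one: "g (kone T) = kone T'"
  using imp[of "\<c>\<^bsub>T\<^esub>" "\<c>\<^bsub>T\<^esub>"]
  by (simp add: ctr source.K3 target.K3 source.ctr_closed target.ctr_closed)

text \<open>Preservation of joins with \<open>\<c>\<close> is not part of the definition of a morphism. With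
  \<open>u = x \<rightharpoonup> \<sim> (x \<squnion> \<c>)\<close> and \<open>v = (x \<squnion> \<c>) \<rightharpoonup> \<sim> (x \<squnion> \<c>)\<close>, (K4) and (K5) give \<open>u \<sqsubseteq> v\<close>, and applying
  (K4) to \<open>g u \<sqsubseteq> g v\<close> bounds \<open>g (x \<squnion> \<c>)\<close> by \<open>g x \<squnion> \<c>\<close>.\<close>

lemma join_ctr:
  assumes x: "x \<in> carrier T"
  shows "g (x \<squnion>\<^bsub>T\<^esub> \<c>\<^bsub>T\<^esub>) = g x \<squnion>\<^bsub>T'\<^esub> \<c>\<^bsub>T'\<^esub>"
proof -
  let ?y = "x \<squnion>\<^bsub>T\<^esub> \<c>\<^bsub>T\<^esub>"
  \<comment> \<open>This consequent lies below \<open>\<c>\<close> and has negation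
    \<open>?y\<close>: its join with \<open>\<c>\<close> collapses to \<open>\<c>\<close>, and it
    contributes exactly the factor \<open>?y\<close> to the second coordinates of \<open>?u\<close>
    and \<open>?v\<close>.\<close>
  let ?n = "\<sim>\<^bsub>T\<^esub> ?y"
  let ?u = "x \<rightharpoonup>\<^bsub>T\<^esub> ?n" and ?v = "?y \<rightharpoonup>\<^bsub>T\<^esub> ?n"
  have y: "?y \<in> carrier T" "\<c>\<^bsub>T\<^esub> \<sqsubseteq>\<^bsub>T\<^esub> ?y" "?y \<squnion>\<^bsub>T\<^esub> \<c>\<^bsub>T\<^esub> = ?y" "?n \<in> carrier T"
    using x by (simp_all add: source.join_ctr_closed source.join_ctr_upper
        source.join_ctr_absorb source.neg_closed)
  have n: "?n \<squnion>\<^bsub>T\<^esub> \<c>\<^bsub>T\<^esub> = \<c>\<^bsub>T\<^esub>" "\<sim>\<^bsub>T\<^esub> ?n = ?y"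
    using y by (simp_all add: source.join_ctr_collapse source.neg_le_ctr_iff source.neg_neg)
  have uv: "?u \<in> carrier T" "?v \<in> carrier T"
    using x y by (simp_all add: source.kimp_closed)
  have "?u \<sqsubseteq>\<^bsub>T\<^esub> ?v"
  proof -
    have "?u \<squnion>\<^bsub>T\<^esub> \<c>\<^bsub>T\<^esub> \<sqsubseteq>\<^bsub>T\<^esub> ?v \<squnion>\<^bsub>T\<^esub> \<c>\<^bsub>T\<^esub>"
    proof -
      let ?w = "?y \<rightharpoonup>\<^bsub>T\<^esub> \<c>\<^bsub>T\<^esub>" and ?z = "?y \<rightharpoonup>\<^bsub>T\<^esub> (\<sim>\<^bsub>T\<^esub> x \<squnion>\<^bsub>T\<^esub> \<c>\<^bsub>T\<^esub>)"
      have w: "?w \<in> carrier T" "\<c>\<^bsub>T\<^esub> \<sqsubseteq>\<^bsub>T\<^esub> ?w" "?z \<in> carrier T"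
        using x y by (simp_all add: source.kimp_closed source.kimp_upper source.ctr_closed
            source.join_ctr_closed source.neg_closed)
      \<comment> \<open>Both factors for \<open>?v\<close> reduce to \<open>?w\<close>, whereas
        \<open>?u\<close> keeps \<open>?z\<close> as one of its factors, so its first coordinate can
        only be smaller.\<close>
      have "?u \<squnion>\<^bsub>T\<^esub> \<c>\<^bsub>T\<^esub> = ?w \<sqinter>\<^bsub>T\<^esub> ?z" "?v \<squnion>\<^bsub>T\<^esub> \<c>\<^bsub>T\<^esub> = ?w \<sqinter>\<^bsub>T\<^esub> ?w"
        using source.kimp_join_ctr[of x ?n] source.kimp_join_ctr[of ?y ?n] x y n by simp_all
      then show ?thesis
        using w by (simp add: source.upper_meet_le_iff source.upper_meet_props)
    qed
    \<comment> \<open>Both second coordinates are the meet of \<open>?y\<close> with itself, since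
      \<open>x\<close> and \<open>?y\<close> have the same join with \<open>\<c>\<close>.\<close>
    moreover have "\<sim>\<^bsub>T\<^esub> ?u \<squnion>\<^bsub>T\<^esub> \<c>\<^bsub>T\<^esub> = \<sim>\<^bsub>T\<^esub> ?v \<squnion>\<^bsub>T\<^esub> \<c>\<^bsub>T\<^esub>"
      using x y n by (simp add: source.neg_kimp_join_ctr)
    ultimately show ?thesis
      using uv source.le_iff_join_ctr[of ?u ?v]
      by (simp add: source.join_ctr_closed source.neg_closed)
  qed
  then have "g ?u \<sqsubseteq>\<^bsub>T'\<^esub> g ?v"
    using mono uv by blast
  \<comment> \<open>The factors that coincide in \<open>T\<close> separate here: the left side is
    the meet of \<open>g ?y\<close> with itself, the right side that of
    \<open>g x \<squnion> \<c>\<close> and \<open>g ?y\<close>.\<close>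
  then have "\<sim>\<^bsub>T'\<^esub> (g ?v) \<squnion>\<^bsub>T'\<^esub> \<c>\<^bsub>T'\<^esub> \<sqsubseteq>\<^bsub>T'\<^esub> \<sim>\<^bsub>T'\<^esub> (g ?u) \<squnion>\<^bsub>T'\<^esub> \<c>\<^bsub>T'\<^esub>"
    using target.le_iff_join_ctr[of "g ?u" "g ?v"] uv closed by simp
  moreover have gy: "g ?y \<in> carrier T'" "\<c>\<^bsub>T'\<^esub> \<sqsubseteq>\<^bsub>T'\<^esub> g ?y" "g x \<in> carrier T'"
    using x y mono[OF source.ctr_closed y(1)] by (simp_all add: closed ctr)
  then have "g ?y \<squnion>\<^bsub>T'\<^esub> \<c>\<^bsub>T'\<^esub> = g ?y"
    by (simp add: target.join_ctr_absorb)
  ultimately have "g ?y \<sqinter>\<^bsub>T'\<^esub> g ?y \<sqsubseteq>\<^bsub>T'\<^esub> (g x \<squnion>\<^bsub>T'\<^esub> \<c>\<^bsub>T'\<^esub>) \<sqinter>\<^bsub>T'\<^esub> g ?y"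
    using gy x y by (simp add: imp neg target.neg_kimp_join_ctr target.neg_closed target.neg_neg)
  moreover have "g ?y \<sqsubseteq>\<^bsub>T'\<^esub> g ?y \<sqinter>\<^bsub>T'\<^esub> g ?y"
    using gy by (simp add: target.upper_meet_le_iff)
  ultimately have "g ?y \<sqsubseteq>\<^bsub>T'\<^esub> (g x \<squnion>\<^bsub>T'\<^esub> \<c>\<^bsub>T'\<^esub>) \<sqinter>\<^bsub>T'\<^esub> g ?y"
    using gy target.le_trans
    by (meson target.join_ctr_closed target.join_ctr_upper(2) target.upper_meet_props(1))
  then have "g ?y \<sqsubseteq>\<^bsub>T'\<^esub> g x \<squnion>\<^bsub>T'\<^esub> \<c>\<^bsub>T'\<^esub>"
    using gy by (simp add: target.upper_meet_le_iff target.join_ctr_closed target.join_ctr_upper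
        target.upper_meet_props)
  moreover have "g x \<squnion>\<^bsub>T'\<^esub> \<c>\<^bsub>T'\<^esub> \<sqsubseteq>\<^bsub>T'\<^esub> g ?y"
    using gy x y mono by (simp add: target.join_ctr_least source.join_ctr_upper)
  ultimately show ?thesis
    using gy by (simp add: target.join_ctr_closed target.le_antisym)
qed

end

locale his_morphism = source: hemi_implicative_semilattice H +
  target: hemi_implicative_semilattice H' for H H' :: "'a his" and f +
  assumes hom: "f \<in> his_hom H H'"
begin

lemma closed: "a \<in> carrier H \<Longrightarrow> f a \<in> carrier H'"
  and meet: "\<lbrakk>a \<in> carrier H; b \<in> carrier H\<rbrakk> \<Longrightarrow> f (a \<curlywedge>\<^bsub>H\<^esub> b) = f a \<curlywedge>\<^bsub>H'\<^esub> f b"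
  and imp: "\<lbrakk>a \<in> carrier H; b \<in> carrier H\<rbrakk> \<Longrightarrow> f (a \<leadsto>\<^bsub>H\<^esub> b) = f a \<leadsto>\<^bsub>H'\<^esub> f b"
  and zero: "f \<zero>\<^bsub>H\<^esub> = \<zero>\<^bsub>H'\<^esub>"
  and one: "f \<one>\<^bsub>H\<^esub> = \<one>\<^bsub>H'\<^esub>"
  using hom by (auto simp: his_hom_def)

lemma mono: "\<lbrakk>a \<in> carrier H; b \<in> carrier H; a \<preceq>\<^bsub>H\<^esub> b\<rbrakk> \<Longrightarrow> f a \<preceq>\<^bsub>H'\<^esub> f b"
  by (metis hle_def meet)

end

section \<open>Inverses of bijective morphisms\<close>

lemma restrict_inv_into_his_hom:
  assumes "his_morphism H H' f" and bij: "bij_betw f (carrier H) (carrier H')"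
  shows "restrict (inv_into (carrier H) f) (carrier H') \<in> his_hom H' H"
proof -
  interpret his_morphism H H' f by fact
  let ?i = "inv_into (carrier H) f"
  have i: "?i y \<in> carrier H" "f (?i y) = y" if "y \<in> carrier H'" for y
    using that bij bij_betw_inv_into_right[OF bij] bij_betw_apply[OF bij_betw_inv_into[OF bij]]
    by auto
  have eqI: "?i y = x" if "f x = y" "x \<in> carrier H" for x y
    using that bij bij_betw_inv_into_left by metis
  have "?i (a \<curlywedge>\<^bsub>H'\<^esub> b) = ?i a \<curlywedge>\<^bsub>H\<^esub> ?i b" "?i (a \<leadsto>\<^bsub>H'\<^esub> b) = ?i a \<leadsto>\<^bsub>H\<^esub> ?i b"
    if "a \<in> carrier H'" "b \<in> carrier H'" for a b
    using that by (auto intro!: eqI simp: meet imp i source.hmeet_closed source.himp_closed)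
  moreover have "?i \<zero>\<^bsub>H'\<^esub> = \<zero>\<^bsub>H\<^esub>" "?i \<one>\<^bsub>H'\<^esub> = \<one>\<^bsub>H\<^esub>"
    by (auto intro!: eqI simp: zero one source.hzero_closed source.hone_closed)
  ultimately show ?thesis
    using i by (simp add: his_hom_def target.hmeet_closed target.himp_closed target.hzero_closed
        target.hone_closed)
qed

text \<open>Reflection of the order makes the inverse monotone. It also keeps preimages of elements
  above \<open>\<c>\<close> above \<open>\<c>\<close>, so that preservation of meets by
  \<open>g\<close> can be applied to them.\<close>

lemma restrict_inv_into_khis_hom:
  assumes "khis_morphism T T' g" and bij: "bij_betw g (carrier T) (carrier T')"
    and reflect: "\<And>x y. \<lbrakk>x \<in> carrier T; y \<in> carrier T; g x \<sqsubseteq>\<^bsub>T'\<^esub> g y\<rbrakk> \<Longrightarrow> x \<sqsubseteq>\<^bsub>T\<^esub> y"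
  shows "restrict (inv_into (carrier T) g) (carrier T') \<in> khis_hom T' T"
proof -
  interpret khis_morphism T T' g by fact
  let ?i = "inv_into (carrier T) g"
  have i: "?i y \<in> carrier T" "g (?i y) = y" if "y \<in> carrier T'" for y
    using that bij bij_betw_inv_into_right[OF bij] bij_betw_apply[OF bij_betw_inv_into[OF bij]]
    by auto
  have eqI: "?i y = x" if "g x = y" "x \<in> carrier T" for x y
    using that bij bij_betw_inv_into_left by metis
  have upper: "\<c>\<^bsub>T\<^esub> \<sqsubseteq>\<^bsub>T\<^esub> ?i y" if "y \<in> carrier T'" "\<c>\<^bsub>T'\<^esub> \<sqsubseteq>\<^bsub>T'\<^esub> y" for y
    using that i reflect by (simp add: ctr source.ctr_closed)
  have "?i (\<sim>\<^bsub>T'\<^esub> x) = \<sim>\<^bsub>T\<^esub> (?i x)" "?i (x \<rightharpoonup>\<^bsub>T'\<^esub> y) = ?i x \<rightharpoonup>\<^bsub>T\<^esub> ?i y"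
    if "x \<in> carrier T'" "y \<in> carrier T'" for x y
    using that by (auto intro!: eqI simp: neg imp i source.neg_closed source.kimp_closed)
  moreover have "?i x \<sqsubseteq>\<^bsub>T\<^esub> ?i y"
    if "x \<in> carrier T'" "y \<in> carrier T'" "x \<sqsubseteq>\<^bsub>T'\<^esub> y" for x y
    using that by (auto intro!: reflect simp: i)
  moreover have "?i (x \<sqinter>\<^bsub>T'\<^esub> y) = ?i x \<sqinter>\<^bsub>T\<^esub> ?i y"
    if "x \<in> carrier T'" "y \<in> carrier T'" "\<c>\<^bsub>T'\<^esub> \<sqsubseteq>\<^bsub>T'\<^esub> x" "\<c>\<^bsub>T'\<^esub> \<sqsubseteq>\<^bsub>T'\<^esub> y" for x y
    using that by (intro eqI) (simp_all add: upper_meet i upper source.upper_meet_props)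
  ultimately show ?thesis
    using i by (simp add: khis_hom_def target.kimp_closed target.neg_closed
        target.upper_meet_props)
qed


section \<open>The categories\<close>

lemma hIS0_simps:
  "Obj hIS0 = {H. hemi_implicative_semilattice H}" "Hom hIS0 = his_hom"
  "Ident hIS0 H = (\<lambda>x\<in>carrier H. x)" "Comp hIS0 H H' H'' g f = compose (carrier H) g f"
  by (simp_all add: hIS0_def)

lemma KhIS0_simps:
  "Obj KhIS0 = {T. kleene_his T}" "Hom KhIS0 = khis_hom"
  "Ident KhIS0 T = (\<lambda>x\<in>carrier T. x)" "Comp KhIS0 T T' T'' g f = compose (carrier T) g f"
  by (simp_all add: KhIS0_def)

lemma KhIS0_CK_simps:
  "Obj KhIS0_CK = {T. kleene_his T \<and> CK T}" "Hom KhIS0_CK = khis_hom"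
  "Ident KhIS0_CK T = (\<lambda>x\<in>carrier T. x)"
  "Comp KhIS0_CK T T' T'' g f = compose (carrier T) g f"
  by (auto simp: KhIS0_CK_def full_subcategory_def KhIS0_def)

lemma his_morphismI:
  "\<lbrakk>H \<in> Obj hIS0; H' \<in> Obj hIS0; f \<in> Hom hIS0 H H'\<rbrakk> \<Longrightarrow> his_morphism H H' f"
  by (simp add: hIS0_simps his_morphism_def his_morphism_axioms_def)

lemma khis_morphismI:
  "\<lbrakk>T \<in> Obj KhIS0; T' \<in> Obj KhIS0; g \<in> Hom KhIS0 T T'\<rbrakk> \<Longrightarrow> khis_morphism T T' g"
  by (simp add: KhIS0_simps khis_morphism_def khis_morphism_axioms_def)

lemma category_full_subcategory:
  assumes "category C"
  shows "category (full_subcategory C P)"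
proof -
  interpret category C by fact
  show ?thesis
    by unfold_locales (simp_all add: full_subcategory_def Ident_in_Hom Comp_in_Hom
        Comp_Ident_left Comp_Ident_right Comp_assoc)
qed

lemma compose_assoc_PiE:
  "f \<in> A \<rightarrow>\<^sub>E B \<Longrightarrow> compose A h (compose A g f) = compose A (compose B h g) f"
  by (auto simp: compose_def restrict_def fun_eq_iff)

lemma category_hIS0: "category hIS0"
proof
  fix X Y Z :: "'a his" and f g
  assume "X \<in> Obj hIS0" "Y \<in> Obj hIS0" "f \<in> Hom hIS0 X Y"
  then interpret f: his_morphism X Y f by (rule his_morphismI)
  assume "Z \<in> Obj hIS0" "g \<in> Hom hIS0 Y Z"
  then interpret g: his_morphism Y Z g by (simp add: his_morphismI \<open>Y \<in> Obj hIS0\<close>)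
  show "Comp hIS0 X Y Z g f \<in> Hom hIS0 X Z"
    by (auto simp: hIS0_simps his_hom_def compose_def f.closed f.meet f.imp f.zero f.one
        g.closed g.meet g.imp g.zero g.one f.source.hmeet_closed f.source.himp_closed
        f.source.hzero_closed f.source.hone_closed)
next
  fix W X Y Z :: "'a his" and f g h
  assume "f \<in> Hom hIS0 W X"
  then show "Comp hIS0 W Y Z h (Comp hIS0 W X Y g f) = Comp hIS0 W X Z (Comp hIS0 X Y Z h g) f"
    by (auto simp: hIS0_simps his_hom_def compose_assoc_PiE)
next
  fix X Y :: "'a his" and f
  assume "f \<in> Hom hIS0 X Y"
  then have f: "f \<in> carrier X \<rightarrow>\<^sub>E carrier Y" by (simp add: hIS0_simps his_hom_def)
  then show "Comp hIS0 X X Y f (Ident hIS0 X) = f"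
    by (auto simp: hIS0_simps compose_def fun_eq_iff restrict_def)
  show "Comp hIS0 X Y Y (Ident hIS0 Y) f = f"
    using f by (auto simp: hIS0_simps compose_def fun_eq_iff restrict_def PiE_iff extensional_def)
qed (auto simp: hIS0_simps his_hom_def hemi_implicative_semilattice.hmeet_closed
    hemi_implicative_semilattice.himp_closed hemi_implicative_semilattice.hzero_closed
    hemi_implicative_semilattice.hone_closed)

lemma category_KhIS0: "category KhIS0"
proof
  fix X :: "'a khis"
  assume "X \<in> Obj KhIS0"
  then interpret kleene_his X by (simp add: KhIS0_simps)
  show "Ident KhIS0 X \<in> Hom KhIS0 X X"
    by (auto simp: KhIS0_simps khis_hom_def neg_closed kimp_closed upper_meet_props)
next
  fix X Y Z :: "'a khis" and f g
  assume "X \<in> Obj KhIS0" "Y \<in> Obj KhIS0" "f \<in> Hom KhIS0 X Y"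
  then interpret f: khis_morphism X Y f by (rule khis_morphismI)
  assume "Z \<in> Obj KhIS0" "g \<in> Hom KhIS0 Y Z"
  then interpret g: khis_morphism Y Z g by (simp add: khis_morphismI \<open>Y \<in> Obj KhIS0\<close>)
  \<comment> \<open>Preservation of meets is granted only above the centre; this makes it available
    for \<open>g\<close> at images under \<open>f\<close>.\<close>
  have "\<c>\<^bsub>Y\<^esub> \<sqsubseteq>\<^bsub>Y\<^esub> f x" if "x \<in> carrier X" "\<c>\<^bsub>X\<^esub> \<sqsubseteq>\<^bsub>X\<^esub> x" for x
    using that f.mono[OF f.source.ctr_closed] by (simp add: f.ctr)
  then show "Comp KhIS0 X Y Z g f \<in> Hom KhIS0 X Z"
    by (auto simp: KhIS0_simps khis_hom_def compose_def f.closed f.mono f.neg f.imp f.upper_meet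
        g.closed g.mono g.neg g.imp g.upper_meet f.source.neg_closed f.source.kimp_closed
        f.source.upper_meet_props)
next
  fix W X Y Z :: "'a khis" and f g h
  assume "f \<in> Hom KhIS0 W X"
  then show "Comp KhIS0 W Y Z h (Comp KhIS0 W X Y g f) = Comp KhIS0 W X Z (Comp KhIS0 X Y Z h g) f"
    by (auto simp: KhIS0_simps khis_hom_def compose_assoc_PiE)
next
  fix X Y :: "'a khis" and f
  assume "f \<in> Hom KhIS0 X Y"
  then have f: "f \<in> carrier X \<rightarrow>\<^sub>E carrier Y" by (simp add: KhIS0_simps khis_hom_def)
  then show "Comp KhIS0 X X Y f (Ident KhIS0 X) = f"
    by (auto simp: KhIS0_simps compose_def fun_eq_iff restrict_def)
  show "Comp KhIS0 X Y Y (Ident KhIS0 Y) f = f"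
    using f by (auto simp: KhIS0_simps compose_def fun_eq_iff restrict_def PiE_iff extensional_def)
qed

lemma category_KhIS0_CK: "category KhIS0_CK"
  unfolding KhIS0_CK_def by (rule category_full_subcategory[OF category_KhIS0])

lemma compose_inv_into_left:
  assumes "bij_betw f A B"
  shows "compose A (restrict (inv_into A f) B) f = (\<lambda>x\<in>A. x)"
  using assms by (auto simp: compose_def restrict_def fun_eq_iff bij_betw_inv_into_left bij_betw_apply)

lemma compose_inv_into_right:
  assumes "bij_betw f A B"
  shows "compose B f (restrict (inv_into A f) B) = (\<lambda>x\<in>B. x)"
  using assms by (auto simp: compose_def restrict_def fun_eq_iff bij_betw_inv_into_right)

lemma iso_arrow_hIS0:
  assumes "his_morphism H H' f" "bij_betw f (carrier H) (carrier H')"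
  shows "iso_arrow hIS0 H H' f"
  using assms restrict_inv_into_his_hom[OF assms] compose_inv_into_left compose_inv_into_right
  by (fastforce simp: iso_arrow_def hIS0_simps his_morphism_def his_morphism_axioms_def)

lemma iso_arrow_KhIS0_CK:
  assumes "khis_morphism T T' g" "bij_betw g (carrier T) (carrier T')"
    and "\<And>x y. \<lbrakk>x \<in> carrier T; y \<in> carrier T; g x \<sqsubseteq>\<^bsub>T'\<^esub> g y\<rbrakk> \<Longrightarrow> x \<sqsubseteq>\<^bsub>T\<^esub> y"
  shows "iso_arrow KhIS0_CK T T' g"
  using assms restrict_inv_into_khis_hom[OF assms] compose_inv_into_left compose_inv_into_right
  by (fastforce simp: iso_arrow_def KhIS0_CK_simps khis_morphism_def khis_morphism_axioms_def)

lemma functor_between_id: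
  assumes "category C"
  shows "functor_between C C id_functor"
proof -
  interpret category C by fact
  show ?thesis by unfold_locales (simp_all add: id_functor_def)
qed

lemma functor_between_comp:
  assumes "functor_between C D F" "functor_between D E G"
  shows "functor_between C E (comp_functor G F)"
proof -
  interpret F: functor_between C D F by fact
  interpret G: functor_between D E G by fact
  show ?thesis
    by unfold_locales (simp_all add: comp_functor_def F.FObj_in_Obj F.FArr_in_Hom F.FArr_Ident
        F.FArr_Comp G.FObj_in_Obj G.FArr_in_Hom G.FArr_Ident G.FArr_Comp)
qed


section \<open>The functors and the natural isomorphisms\<close>

lemma K_arr_hom:
  fixes H H' :: "'a universe his"
  assumes "his_morphism H H' f"
  shows "(\<lambda>p\<in>carrier (K_obj H). Pr (f (pr1 p)) (f (pr2 p))) \<in> khis_hom (K_obj H) (K_obj H')"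
proof -
  interpret his_morphism H H' f by fact
  interpret KH: universe_his H by unfold_locales
  interpret KH': universe_his H' by unfold_locales
  interpret T: kleene_his "K_obj H" by (rule KH.kleene_his_K_obj)
  let ?g = "\<lambda>p\<in>carrier (K_obj H). Pr (f (pr1 p)) (f (pr2 p))"
  have disj: "f a \<curlywedge>\<^bsub>H'\<^esub> f b = \<zero>\<^bsub>H'\<^esub>" if "a \<in> carrier H" "b \<in> carrier H" "a \<curlywedge>\<^bsub>H\<^esub> b = \<zero>\<^bsub>H\<^esub>" for a b
    using that meet zero by metis
  have "?g \<in> carrier (K_obj H) \<rightarrow>\<^sub>E carrier (K_obj H')"
    by (auto elim!: KH.K_obj_cases simp: KH'.K_obj_simps closed disj)
  moreover have "?g x \<sqsubseteq>\<^bsub>K_obj H'\<^esub> ?g y"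
    if "x \<in> carrier (K_obj H)" "y \<in> carrier (K_obj H)" "x \<sqsubseteq>\<^bsub>K_obj H\<^esub> y" for x y
    using that by (auto elim!: KH.K_obj_cases simp: KH.K_obj_simps KH'.K_obj_simps mono)
  moreover have "?g (\<sim>\<^bsub>K_obj H\<^esub> x) = \<sim>\<^bsub>K_obj H'\<^esub> (?g x)" if "x \<in> carrier (K_obj H)" for x
    using that T.neg_closed[OF that]
    by (auto elim!: KH.K_obj_cases simp: KH.K_obj_simps KH'.K_obj_simps)
  moreover have "?g (x \<rightharpoonup>\<^bsub>K_obj H\<^esub> y) = ?g x \<rightharpoonup>\<^bsub>K_obj H'\<^esub> ?g y"
    if "x \<in> carrier (K_obj H)" "y \<in> carrier (K_obj H)" for x y
    using that T.kimp_closed[OF that]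
    by (auto elim!: KH.K_obj_cases simp: KH.K_obj_simps KH'.K_obj_simps meet imp
        source.himp_closed source.hmeet_closed)
  moreover have "?g (x \<sqinter>\<^bsub>K_obj H\<^esub> y) = ?g x \<sqinter>\<^bsub>K_obj H'\<^esub> ?g y"
    if xy: "x \<in> carrier (K_obj H)" "y \<in> carrier (K_obj H)"
      "\<c>\<^bsub>K_obj H\<^esub> \<sqsubseteq>\<^bsub>K_obj H\<^esub> x" "\<c>\<^bsub>K_obj H\<^esub> \<sqsubseteq>\<^bsub>K_obj H\<^esub> y" for x y
  proof -
    obtain a b where "x = Pr a \<zero>\<^bsub>H\<^esub>" "y = Pr b \<zero>\<^bsub>H\<^esub>" "a \<in> carrier H" "b \<in> carrier H"
      using xy by (auto elim!: KH.K_obj_cases simp: KH.K_obj_simps source.hle_hzero_iff)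
    then show ?thesis
      by (simp add: KH.K_obj_simps KH.K_obj_lattice_simps KH'.K_obj_lattice_simps meet zero closed
          source.hmeet_closed source.hmeet_hzero source.hzero_closed target.hmeet_hzero target.hzero_closed)
  qed
  ultimately show ?thesis
    unfolding khis_hom_def by blast
qed

lemma functor_between_K: "functor_between hIS0 KhIS0_CK K_functor"
proof (intro functor_between.intro functor_between_axioms.intro category_hIS0 category_KhIS0_CK)
  fix X :: "'a universe his"
  assume "X \<in> Obj hIS0"
  then interpret universe_his X by (simp add: hIS0_simps universe_his_def)
  show "FObj K_functor X \<in> Obj KhIS0_CK"
    by (simp add: K_functor_def KhIS0_CK_simps kleene_his_K_obj CK_K_obj)
  show "FArr K_functor X X (Ident hIS0 X) = Ident KhIS0_CK (FObj K_functor X)"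
    by (auto simp: K_functor_def KhIS0_CK_simps hIS0_simps fun_eq_iff restrict_def K_obj_simps
        elim!: K_obj_cases)
next
  fix X Y :: "'a universe his" and f
  assume "X \<in> Obj hIS0" "Y \<in> Obj hIS0" "f \<in> Hom hIS0 X Y"
  then have "his_morphism X Y f" by (rule his_morphismI)
  then show "FArr K_functor X Y f \<in> Hom KhIS0_CK (FObj K_functor X) (FObj K_functor Y)"
    using K_arr_hom by (simp add: K_functor_def KhIS0_CK_simps)
next
  fix X Y Z :: "'a universe his" and f g
  assume "X \<in> Obj hIS0" "Y \<in> Obj hIS0" "f \<in> Hom hIS0 X Y"
  then interpret his_morphism X Y f by (rule his_morphismI)
  interpret X: universe_his X by unfold_locales
  interpret Y: universe_his Y by unfold_locales
  \<comment> \<open>Arrow maps are extensional, so the outer one computes as expected only once the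
    inner values are known to lie in its carrier.\<close>
  have "Pr (f a) (f b) \<in> carrier (K_obj Y)"
    if "a \<in> carrier X" "b \<in> carrier X" "a \<curlywedge>\<^bsub>X\<^esub> b = \<zero>\<^bsub>X\<^esub>" for a b
    using that meet[of a b] zero closed by (simp add: Y.K_obj_simps)
  then show "FArr K_functor X Z (Comp hIS0 X Y Z g f) =
      Comp KhIS0_CK (FObj K_functor X) (FObj K_functor Y) (FObj K_functor Z)
        (FArr K_functor Y Z g) (FArr K_functor X Y f)"
    by (auto simp: K_functor_def KhIS0_CK_simps hIS0_simps fun_eq_iff restrict_def compose_def
        elim!: X.K_obj_cases)
qed

lemma functor_between_C: "functor_between KhIS0_CK hIS0 C_functor"
proof (intro functor_between.intro functor_between_axioms.intro category_hIS0 category_KhIS0_CK)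
  fix X :: "'a khis"
  assume "X \<in> Obj KhIS0_CK"
  then interpret kleene_his X by (simp add: KhIS0_CK_simps)
  show "FObj C_functor X \<in> Obj hIS0"
    by (simp add: C_functor_def hIS0_simps hemi_implicative_semilattice_C_obj)
  show "FArr C_functor X X (Ident KhIS0_CK X) = Ident hIS0 (FObj C_functor X)"
    by (auto simp: C_functor_def KhIS0_CK_simps hIS0_simps fun_eq_iff restrict_def C_obj_simps)
next
  fix X Y :: "'a khis" and g
  assume "X \<in> Obj KhIS0_CK" "Y \<in> Obj KhIS0_CK" "g \<in> Hom KhIS0_CK X Y"
  then interpret khis_morphism X Y g
    by (simp add: KhIS0_CK_simps khis_morphism_def khis_morphism_axioms_def)
  have upper: "\<c>\<^bsub>Y\<^esub> \<sqsubseteq>\<^bsub>Y\<^esub> g x" if "x \<in> carrier X" "\<c>\<^bsub>X\<^esub> \<sqsubseteq>\<^bsub>X\<^esub> x" for x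
    using that mono[OF source.ctr_closed] by (simp add: ctr)
  then show "FArr C_functor X Y g \<in> Hom hIS0 (FObj C_functor X) (FObj C_functor Y)"
    by (auto simp: C_functor_def hIS0_simps his_hom_def source.C_obj_simps target.C_obj_simps closed
        imp upper_meet ctr one source.kimp_closed source.kimp_upper source.upper_meet_props
        source.ctr_closed source.kone_closed source.le_kone)
  \<comment> \<open>Restricting a composite agrees with composing restrictions because
    \<open>g\<close> sends the upper part of \<open>X\<close> into that of \<open>Y\<close>.\<close>
  fix Z :: "'a khis" and h
  show "FArr C_functor X Z (Comp KhIS0_CK X Y Z h g) =
      Comp hIS0 (FObj C_functor X) (FObj C_functor Y) (FObj C_functor Z)
        (FArr C_functor Y Z h) (FArr C_functor X Y g)"
    using upper closed by (auto simp: C_functor_def KhIS0_CK_simps hIS0_simps fun_eq_iff restrict_def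
        compose_def source.C_obj_simps target.C_obj_simps)
qed

section \<open>The components of the unit\<close>

context universe_his
begin

interpretation K: kleene_his "K_obj H"
  by (rule kleene_his_K_obj)

lemma C_K_obj_carrier: "carrier (C_obj (K_obj H)) = {Pr a \<zero> | a. a \<in> carrier H}"
  by (auto simp: K.C_obj_simps K_obj_simps hzero_least hmeet_hzero hzero_closed hle_hzero_iff
      elim!: K_obj_cases)

lemma his_morphism_alpha: "his_morphism H (C_obj (K_obj H)) (alpha H)"
proof -
  have "alpha H \<in> his_hom H (C_obj (K_obj H))"
    by (auto simp: his_hom_def alpha_def C_K_obj_carrier K.C_obj_simps(2-) K_obj_simps
        K_obj_lattice_simps K_obj_closed_simps hmeet_hzero hmeet_hone himp_self)
  then show ?thesis
    by (simp add: his_morphism_def his_morphism_axioms_def hemi_implicative_semilattice_axioms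
        K.hemi_implicative_semilattice_C_obj)
qed

lemma bij_betw_alpha: "bij_betw (alpha H) (carrier H) (carrier (C_obj (K_obj H)))"
  by (auto simp: bij_betw_def inj_on_def alpha_def C_K_obj_carrier)

end

section \<open>The components of the counit\<close>

locale universe_khis = kleene_his T
  for T :: "'a universe khis" (structure)
begin

sublocale C: universe_his "C_obj T"
  by (simp add: universe_his_def hemi_implicative_semilattice_C_obj)

lemma C_obj_upper: "x \<in> carrier T \<Longrightarrow> x \<squnion> \<c> \<in> carrier (C_obj T)"
  by (simp add: C_obj_simps join_ctr_closed join_ctr_upper)

lemma K_C_obj_carrier:
  "Pr a b \<in> carrier (K_obj (C_obj T)) \<longleftrightarrow>
    a \<in> carrier T \<and> b \<in> carrier T \<and> \<c> \<sqsubseteq> a \<and> \<c> \<sqsubseteq> b \<and> a \<sqinter> b = \<c>"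
  by (auto simp: C.K_obj_simps C_obj_simps)

lemma K_C_obj_le_iff:
  assumes "x \<in> carrier T" "y \<in> carrier T"
  shows "beta T x \<sqsubseteq>\<^bsub>K_obj (C_obj T)\<^esub> beta T y \<longleftrightarrow> x \<sqsubseteq> y"
  using assms le_iff_join_ctr[of x y]
  by (simp add: beta_def C.K_obj_simps C_obj_le_iff C_obj_upper neg_closed)

text \<open>The Kleene condition places the pair in the carrier, and \<open>kimp_join_ctr\<close>
  with \<open>neg_kimp_join_ctr\<close> are the two coordinates of preservation of
  implication.\<close>

lemma khis_morphism_beta: "khis_morphism T (K_obj (C_obj T)) (beta T)"
proof -
  have "(x \<squnion> \<c>) \<sqinter> (\<sim> x \<squnion> \<c>) = \<c>" if "x \<in> carrier T" for x
    using meet_eqI[OF kleene[OF that]] .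
  then have closed: "beta T \<in> carrier T \<rightarrow>\<^sub>E carrier (K_obj (C_obj T))"
    by (auto simp: beta_def K_C_obj_carrier join_ctr_closed join_ctr_upper neg_closed)
  have neg: "beta T (\<sim> x) = \<sim>\<^bsub>K_obj (C_obj T)\<^esub> (beta T x)" if "x \<in> carrier T" for x
    using that by (simp add: beta_def C.K_obj_simps neg_closed neg_neg)
  have imp: "beta T (x \<rightharpoonup> y) = beta T x \<rightharpoonup>\<^bsub>K_obj (C_obj T)\<^esub> beta T y"
    if "x \<in> carrier T" "y \<in> carrier T" for x y
    using that by (simp add: beta_def C.K_obj_simps C_obj_simps kimp_closed kimp_join_ctr
        neg_kimp_join_ctr)
  have upper: "beta T x = Pr x \<c>" if "x \<in> carrier T" "\<c> \<sqsubseteq> x" for x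
    using that by (simp add: beta_def join_ctr_absorb join_ctr_collapse neg_closed neg_le_ctr_iff)
  have meet: "beta T (x \<sqinter> y) = beta T x \<sqinter>\<^bsub>K_obj (C_obj T)\<^esub> beta T y"
    if "x \<in> carrier T" "y \<in> carrier T" "\<c> \<sqsubseteq> x" "\<c> \<sqsubseteq> y" for x y
  proof -
    have "x \<in> carrier (C_obj T)" "y \<in> carrier (C_obj T)"
      using that by (simp_all add: C_obj_simps)
    then have "Pr x \<c> \<sqinter>\<^bsub>K_obj (C_obj T)\<^esub> Pr y \<c> = Pr (x \<sqinter> y) \<c>"
      using C.K_obj_lattice_simps(3)[of x y \<c>] C.hzero_closed C.hmeet_hzero(1)[of y]
      by (simp add: C_obj_simps(2-))
    then show ?thesis
      using that ctr_closed by (simp add: upper upper_meet_props)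
  qed
  have "beta T \<in> khis_hom T (K_obj (C_obj T))"
    using closed by (simp add: khis_hom_def neg imp meet K_C_obj_le_iff)
  then show ?thesis
    by (simp add: khis_morphism_def khis_morphism_axioms_def kleene_his_axioms C.kleene_his_K_obj)
qed

lemma bij_betw_beta:
  assumes "CK T"
  shows "bij_betw (beta T) (carrier T) (carrier (K_obj (C_obj T)))"
proof -
  interpret khis_morphism T "K_obj (C_obj T)" "beta T" by (rule khis_morphism_beta)
  have "inj_on (beta T) (carrier T)"
  proof (rule inj_onI)
    fix x y
    assume xy: "x \<in> carrier T" "y \<in> carrier T" and eq: "beta T x = beta T y"
    \<comment> \<open>After rewriting with \<open>eq\<close>, all three equivalences have the same
      left side; the instance at \<open>x\<close> and \<open>x\<close> makes it true by
      reflexivity.\<close>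
    have "x \<sqsubseteq> y" "y \<sqsubseteq> x"
      using xy K_C_obj_le_iff[OF xy] K_C_obj_le_iff[OF xy(2,1)] K_C_obj_le_iff[of x x]
      unfolding eq by simp_all
    then show "x = y"
      using xy by (simp add: le_antisym)
  qed
  moreover have "p \<in> beta T ` carrier T" if p: "p \<in> carrier (K_obj (C_obj T))" for p
  proof -
    obtain a b where ab: "p = Pr a b" "a \<in> carrier T" "b \<in> carrier T" "\<c> \<sqsubseteq> a" "\<c> \<sqsubseteq> b" "a \<sqinter> b = \<c>"
      using p by (auto elim!: C.K_obj_cases simp: C_obj_simps)
    \<comment> \<open>The equation between choice terms becomes a genuine infimum, as (CK) demands,
      because meets with elements above \<open>\<c>\<close> exist.\<close>
    then have "is_glb T \<c> {a, b}"
      using is_glb_upper_meet by metis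
    then obtain z where "z \<in> carrier T" "z \<squnion> \<c> = a" "\<sim> z \<squnion> \<c> = b"
      using assms ab unfolding CK_def by blast
    then show ?thesis
      using ab by (auto simp: beta_def image_iff)
  qed
  ultimately show ?thesis
    using closed by (auto simp: bij_betw_def)
qed

end

lemma natural_isomorphism_alpha:
  "natural_isomorphism (hIS0 :: ('a universe his, 'a universe \<Rightarrow> 'a universe) category_data) hIS0
    id_functor (comp_functor C_functor K_functor) alpha"
proof (intro natural_isomorphism.intro natural_transformation.intro
    natural_transformation_axioms.intro natural_isomorphism_axioms.intro
    functor_between_id category_hIS0 functor_between_comp[OF functor_between_K functor_between_C])
  fix X :: "'a universe his"
  assume "X \<in> Obj hIS0"
  then interpret universe_his X by (simp add: hIS0_simps universe_his_def)
  show "iso_arrow hIS0 (FObj id_functor X) (FObj (comp_functor C_functor K_functor) X) (alpha X)"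
    using iso_arrow_hIS0[OF his_morphism_alpha bij_betw_alpha]
    by (simp add: id_functor_def comp_functor_def C_functor_def K_functor_def)
  then show "alpha X \<in> Hom hIS0 (FObj id_functor X) (FObj (comp_functor C_functor K_functor) X)"
    by (simp add: iso_arrow_def id_functor_def comp_functor_def C_functor_def K_functor_def)
next
  fix X Y :: "'a universe his" and f
  assume "X \<in> Obj hIS0" "Y \<in> Obj hIS0" "f \<in> Hom hIS0 X Y"
  then interpret his_morphism X Y f by (rule his_morphismI)
  interpret X: universe_his X by unfold_locales
  interpret Y: universe_his Y by unfold_locales
  have "Pr a \<zero>\<^bsub>X\<^esub> \<in> carrier (C_obj (K_obj X)) \<inter> carrier (K_obj X)" if "a \<in> carrier X" for a
    using that by (simp add: X.C_K_obj_carrier X.K_obj_simps source.hzero_closed source.hmeet_hzero)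
  then show "Comp hIS0 (FObj id_functor X) (FObj id_functor Y)
        (FObj (comp_functor C_functor K_functor) Y) (alpha Y) (FArr id_functor X Y f) =
      Comp hIS0 (FObj id_functor X) (FObj (comp_functor C_functor K_functor) X)
        (FObj (comp_functor C_functor K_functor) Y)
        (FArr (comp_functor C_functor K_functor) X Y f) (alpha X)"
    by (auto simp: id_functor_def comp_functor_def C_functor_def K_functor_def hIS0_simps
        compose_def fun_eq_iff restrict_def alpha_def closed zero)
qed

lemma natural_isomorphism_beta:
  "natural_isomorphism
    (KhIS0_CK :: ('a universe khis, 'a universe \<Rightarrow> 'a universe) category_data) KhIS0_CK
    id_functor (comp_functor K_functor C_functor) beta"
proof (intro natural_isomorphism.intro natural_transformation.intro
    natural_transformation_axioms.intro natural_isomorphism_axioms.intro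
    functor_between_id category_KhIS0_CK functor_between_comp[OF functor_between_C functor_between_K])
  fix X :: "'a universe khis"
  assume X: "X \<in> Obj KhIS0_CK"
  then interpret universe_khis X by (simp add: KhIS0_CK_simps universe_khis_def)
  have "CK X" using X by (simp add: KhIS0_CK_simps)
  then show "iso_arrow KhIS0_CK (FObj id_functor X) (FObj (comp_functor K_functor C_functor) X) (beta X)"
    using iso_arrow_KhIS0_CK[OF khis_morphism_beta bij_betw_beta] K_C_obj_le_iff
    by (simp add: id_functor_def comp_functor_def C_functor_def K_functor_def)
  then show "beta X \<in> Hom KhIS0_CK (FObj id_functor X) (FObj (comp_functor K_functor C_functor) X)"
    by (simp add: iso_arrow_def id_functor_def comp_functor_def C_functor_def K_functor_def)
next
  fix X Y :: "'a universe khis" and g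
  assume "X \<in> Obj KhIS0_CK" "Y \<in> Obj KhIS0_CK" "g \<in> Hom KhIS0_CK X Y"
  then interpret khis_morphism X Y g
    by (simp add: KhIS0_CK_simps khis_morphism_def khis_morphism_axioms_def)
  interpret X: universe_khis X by unfold_locales
  interpret Y: universe_khis Y by unfold_locales
  interpret bX: khis_morphism X "K_obj (C_obj X)" "beta X" by (rule X.khis_morphism_beta)
  have "Pr (x \<squnion>\<^bsub>X\<^esub> \<c>\<^bsub>X\<^esub>) (\<sim>\<^bsub>X\<^esub> x \<squnion>\<^bsub>X\<^esub> \<c>\<^bsub>X\<^esub>) \<in> carrier (K_obj (C_obj X))" if "x \<in> carrier X" for x
    using bX.closed[OF that] that by (simp add: beta_def)
  \<comment> \<open>The first coordinate is \<open>join_ctr\<close> at \<open>x\<close>; the second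
    is \<open>join_ctr\<close> at \<open>\<sim> x\<close> combined with preservation of
    negation.\<close>
  then show "Comp KhIS0_CK (FObj id_functor X) (FObj id_functor Y)
        (FObj (comp_functor K_functor C_functor) Y) (beta Y) (FArr id_functor X Y g) =
      Comp KhIS0_CK (FObj id_functor X) (FObj (comp_functor K_functor C_functor) X)
        (FObj (comp_functor K_functor C_functor) Y)
        (FArr (comp_functor K_functor C_functor) X Y g) (beta X)"
    by (auto simp: id_functor_def comp_functor_def C_functor_def K_functor_def KhIS0_CK_simps
        compose_def fun_eq_iff restrict_def beta_def closed join_ctr neg X.C_obj_upper
        source.neg_closed)
qed

theorem theorem40:
  shows "categorical_equivalence
    (hIS0 :: ('a universe his, 'a universe \<Rightarrow> 'a universe) category_data) KhIS0_CK
    K_functor C_functor alpha beta"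
  by (intro categorical_equivalence.intro functor_between_K functor_between_C
      natural_isomorphism_alpha natural_isomorphism_beta)

end
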